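(* Let $x_1,\dots,x_T$ be points drawn independently and uniformly at random from $[0,1]$, revealed one at a time. There is an online algorithm which selects signs $\chi_t\in\{\pm1\}$ such that, with high probability, for every interval $I\subseteq[0,1]$, \[\max_{t\in[T]}\mathsf{disc}_t(I)=O(\log^3 T).\] Moreover, for any online algorithm, with constant probability, $\max_{I\subseteq[0,1]}\max_{t\in[T]}\mathsf{disc}_t(I)=\Omega(\sqrt{\log T})$.
   Context: For a signing $\chi_1,\dots,\chi_T$ and an interval $I$, $\mathsf{disc}_t(I):=\left|\sum_{s=1}^t\chi_s\mathbf{1}_I(x_s)\right|$, where $\mathbf{1}_I$ is the indicator function of $I$. An online algorithm must choose $\chi_t$ irrevocably after seeing $x_1,\dots,x_t$ only. "With high probability" means with probability $1-1/\mathrm{poly}(T)$, where the exponent of the polynomial can be made as large as desired by increasing the constant in the discrepancy bound. Logarithms are base $2$. *)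

theory Defs
  imports "HOL-Probability.Probability"
begin

definition points :: "nat \<Rightarrow> (nat \<Rightarrow> real) measure" where
  "points T = PiM {1..T} (\<lambda>_. uniform_measure lborel {0..1})"

text \<open>
  The sign chosen at time \<open>t\<close> is \<open>A t\<close> evaluated on the tuple
  \<open>(x\<^sub>1, \<dots>, x\<^sub>t)\<close>, an element of the product space indexed by \<open>{1..t}\<close>, so it
  cannot depend on later points.  The codomain \<open>count_space {-1, 1}\<close> forces the
  values to be signs; Borel measurability is what makes probabilities of
  events about the signing meaningful.
\<close>

definition online_algorithm :: "nat \<Rightarrow> (nat \<Rightarrow> (nat \<Rightarrow> real) \<Rightarrow> real) \<Rightarrow> bool" where
  "online_algorithm T A \<longleftrightarrow>
     (\<forall>t\<in>{1..T}. A t \<in> PiM {1..t} (\<lambda>_. borel) \<rightarrow>\<^sub>M count_space {-1, 1})"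

text \<open>
  A randomized algorithm additionally reads a random seed \<open>r\<close> drawn from \<open>N\<close>; the
  seed is made independent of the points by running the algorithm on
  \<open>N \<Otimes>\<^sub>M points T\<close>.  A point mass \<open>N\<close> gives back the deterministic algorithms.
\<close>

definition randomized_online_algorithm ::
    "'r measure \<Rightarrow> nat \<Rightarrow> ('r \<Rightarrow> nat \<Rightarrow> (nat \<Rightarrow> real) \<Rightarrow> real) \<Rightarrow> bool" where
  "randomized_online_algorithm N T A \<longleftrightarrow>
     (\<forall>t\<in>{1..T}. (\<lambda>(r, x). A r t x) \<in>
        N \<Otimes>\<^sub>M PiM {1..t} (\<lambda>_. borel) \<rightarrow>\<^sub>M count_space {-1, 1})"

definition signing :: "(nat \<Rightarrow> (nat \<Rightarrow> real) \<Rightarrow> real) \<Rightarrow> (nat \<Rightarrow> real) \<Rightarrow> nat \<Rightarrow> real" where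
  "signing A x t = A t (restrict x {1..t})"

definition disc :: "(nat \<Rightarrow> real) \<Rightarrow> (nat \<Rightarrow> real) \<Rightarrow> nat \<Rightarrow> real set \<Rightarrow> real" where
  "disc \<sigma> x t I = \<bar>\<Sum>s=1..t. \<sigma> s * indicator I (x s)\<bar>"

definition unit_subintervals :: "real set set" where
  "unit_subintervals = {I. is_interval I \<and> I \<subseteq> {0..1}}"

end

theory Submission
  imports Defs
begin

text \<open>
  Upper bound. Cut \<open>[0, 1]\<close> into \<open>2\<^sup>N\<close> dyadic cells with \<open>T \<le> 2\<^sup>N \<le> 2 T\<close> and let \<open>d\<^sub>p\<close> be the signed sum of
  the Haar function \<open>p\<close> over the points seen so far. The sign is chosen greedily for the potential
  \<open>\<Sum>\<^sub>p cosh (d\<^sub>p / (N + 1))\<close>. Orthogonality gives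
  \<open>(N + 1) E \<bar>\<Sum>\<^sub>p a\<^sub>p h\<^sub>p\<bar> \<ge> \<Sum>\<^sub>p \<bar>a\<^sub>p\<bar> E \<bar>h\<^sub>p\<bar>\<close>, so the first-order gain of the greedy choice absorbs the
  second-order loss up to an additive term, and the expected potential stays polynomial. By Markov's
  inequality every \<open>d\<^sub>p\<close> is \<open>O(log\<^sup>2 T)\<close>; an interval is a difference of two dyadic prefixes, each a sum of
  \<open>O(log T)\<close> dyadic blocks, up to the points in its two boundary cells.

  Lower bound (Roth's orthogonal function argument, valid for every signing). Regard the signed
  points as a colouring of \<open>{0..<2\<^sup>K} \<times> [0, 1]\<close>, time against position. For each \<open>a < K\<close>, products of a
  Haar function of scale \<open>2\<^bsup>a+1\<^esup>\<close> in time and of complementary scale in space live on rectangles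
  with one half of a point on average. With constant probability a constant fraction of them
  contains an isolated point, whose contribution to the Haar coefficient cannot cancel. The \<open>K\<close>
  scales are orthogonal, so the prefix discrepancy has maximum at least of order \<open>sqrt K\<close>.
\<close>

section \<open>Haar functions on dyadic cells\<close>

lemma sum_div_const:
  fixes f :: "nat \<Rightarrow> real"
  assumes "k > 0"
  shows "(\<Sum>u<m * k. f (u div k)) = real k * (\<Sum>i<m. f i)"
proof -
  have "(\<Sum>u<m * k. f (u div k)) = (\<Sum>i<m. \<Sum>u\<in>{i * k..<i * k + k}. f (u div k))"
    by (rule sum.nat_group [symmetric])
  also have "\<dots> = (\<Sum>i<m. \<Sum>u\<in>{i * k..<i * k + k}. f i)"
  proof (intro sum.cong refl)
    fix i u assume "u \<in> {i * k..<i * k + k}"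
    then have "u div k = i"
      by (intro div_nat_eqI) (auto simp: mult.commute)
    then show "f (u div k) = f i" by simp
  qed
  finally show ?thesis by (simp add: sum_distrib_left)
qed

lemma sum_even_odd:
  fixes f :: "nat \<Rightarrow> real"
  shows "(\<Sum>v<2 * M. f v) = (\<Sum>i<M. f (2 * i) + f (2 * i + 1))"
  by (induction M) (auto simp: algebra_simps)

definition haar :: "nat \<times> nat \<Rightarrow> nat \<Rightarrow> real" where
  "haar p u = (if u div 2 ^ Suc (fst p) = snd p
     then (if even (u div 2 ^ fst p) then 1 else - 1) else 0)"

text \<open>Level \<open>N\<close> is deliberate: truncated subtraction gives it the single index
  \<open>(N, 0)\<close>, and on \<open>{..<2 ^ N}\<close> that function is the constant 1. With it
  the family has \<open>2 ^ N\<close> members and is an orthogonal basis.\<close>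

definition haar_index :: "nat \<Rightarrow> (nat \<times> nat) set" where
  "haar_index N = (SIGMA l:{..N}. {..<2 ^ (N - 1 - l)})"

lemma finite_haar_index [simp, intro]: "finite (haar_index N)"
  by (simp add: haar_index_def)

lemma haar_cases: "haar p u = -1 \<or> haar p u = 0 \<or> haar p u = 1"
  by (auto simp: haar_def)

lemma abs_haar_le: "\<bar>haar p u\<bar> \<le> 1"
  using haar_cases [of p u] by auto

lemma haar_mult_self: "haar p u * haar p u = \<bar>haar p u\<bar>"
  using haar_cases [of p u] by auto

lemma div_pow_Suc: "(u::nat) div 2 ^ Suc l = (u div 2 ^ l) div 2"
  by (metis div_mult2_eq power_Suc2)

text \<open>On each block of length \<open>2 ^ Suc l\<close> the second factor is constant, so the
  two halves of the Haar function cancel.\<close>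

lemma sum_haar_mult_coarser:
  assumes "l < N"
  shows "(\<Sum>u<2 ^ N. haar (l, i) u * g (u div 2 ^ Suc l)) = 0"
proof -
  define f where "f v = (if v div 2 = i then (if even v then 1 else - 1) else 0) * g (v div 2)" for v
  have N: "2 ^ N = (2 * 2 ^ (N - Suc l)) * (2::nat) ^ l"
    using assms by (metis Suc_diff_Suc add_diff_inverse_nat add.commute not_less_eq
        less_imp_not_less power_Suc power_add)
  have "(\<Sum>u<2 ^ N. haar (l, i) u * g (u div 2 ^ Suc l)) = (\<Sum>u<2 ^ N. f (u div 2 ^ l))"
    unfolding f_def haar_def div_pow_Suc by (intro sum.cong refl) auto
  also have "\<dots> = 2 ^ l * (\<Sum>v<2 * 2 ^ (N - Suc l). f v)"
    unfolding N by (subst sum_div_const) auto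
  also have "(\<Sum>v<2 * 2 ^ (N - Suc l). f v) = 0"
    unfolding sum_even_odd by (intro sum.neutral) (auto simp: f_def)
  finally show ?thesis by simp
qed

text \<open>The function of larger scale is constant on the blocks of the smaller one, so
  \<open>sum_haar_mult_coarser\<close> applies. The case \<open>q = (N, 0)\<close> says that the
  other Haar functions have mean zero.\<close>

lemma haar_orthogonal_less:
  assumes "fst p < fst q" "fst q \<le> N"
  shows "(\<Sum>u<2 ^ N. haar p u * haar q u) = 0"
proof -
  obtain l i where p: "p = (l, i)" by force
  define c where "c = fst q - Suc l"
  have l: "fst q = Suc l + c" using assms p by (simp add: c_def)
  have *: "u div 2 ^ fst q = u div 2 ^ Suc l div 2 ^ c" for u :: nat
    unfolding l power_add by (rule div_mult2_eq)
  define g where "g v = (if v div 2 ^ c div 2 = snd q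
     then (if even (v div 2 ^ c) then 1 else - 1) else (0::real))" for v :: nat
  have "haar q u = g (u div 2 ^ Suc l)" for u
    unfolding haar_def g_def div_pow_Suc [of u "fst q"] * by simp
  then show ?thesis
    using sum_haar_mult_coarser [of l N i g] assms p by simp
qed

text \<open>Different levels are handled by the previous lemma; distinct functions of one level have
  disjoint supports.\<close>

lemma haar_orthogonal:
  assumes "p \<noteq> q" "fst p \<le> N" "fst q \<le> N"
  shows "(\<Sum>u<2 ^ N. haar p u * haar q u) = 0"
proof -
  consider "fst p < fst q" | "fst q < fst p" | "fst p = fst q" by linarith
  then show ?thesis
  proof cases
    case 1 then show ?thesis using haar_orthogonal_less assms by blast
  next
    case 2 then show ?thesis using haar_orthogonal_less [of q p N] assms by (simp add: mult.commute)
  next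
    case 3
    then show ?thesis using assms
      by (intro sum.neutral) (auto simp: haar_def prod_eq_iff)
  qed
qed

lemma sum_abs_haar:
  assumes "l < N" "i < 2 ^ (N - 1 - l)"
  shows "(\<Sum>u<2 ^ N. \<bar>haar (l, i) u\<bar>) = 2 ^ Suc l"
proof -
  have N: "2 ^ N = 2 ^ (N - 1 - l) * (2::nat) ^ Suc l"
    using assms by (simp del: power_Suc flip: power_add)
  have "(\<Sum>u<2 ^ N. \<bar>haar (l, i) u\<bar>) = (\<Sum>u<2 ^ N. (\<lambda>v. if v = i then 1 else 0) (u div 2 ^ Suc l))"
    by (intro sum.cong) (auto simp: haar_def)
  also have "\<dots> = real (2 ^ Suc l) * (\<Sum>v<2 ^ (N - 1 - l). if v = i then 1 else 0)"
    unfolding N by (rule sum_div_const) simp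
  finally show ?thesis using assms by (simp del: power_Suc)
qed

text \<open>The blocks of one level are disjoint, so at most one summand is nonzero at
  \<open>u\<close>.\<close>

lemma haar_level_le_1:
  assumes "\<And>i. \<bar>c i\<bar> \<le> 1"
  shows "\<bar>\<Sum>i<M. c i * haar (l, i) u\<bar> \<le> 1"
proof -
  have "(\<Sum>i<M. c i * haar (l, i) u) =
     (\<Sum>i<M. if i = u div 2 ^ Suc l then c i * haar (l, i) u else 0)"
    by (intro sum.cong) (auto simp: haar_def)
  also have "\<bar>\<dots>\<bar> \<le> 1"
    using mult_mono [OF assms abs_haar_le] by (auto simp: sum.delta abs_mult simp del: power_Suc)
  finally show ?thesis .
qed

text \<open>Each level is tested against its own sign pattern, a function bounded by 1 that is
  orthogonal to all other levels.\<close>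

lemma haar_sum_l1_lower_bound:
  "(\<Sum>p\<in>haar_index N. \<bar>a p\<bar> * (\<Sum>u<2 ^ N. \<bar>haar p u\<bar>))
     \<le> (real N + 1) * (\<Sum>u<2 ^ N. \<bar>\<Sum>p\<in>haar_index N. a p * haar p u\<bar>)"
proof -
  let ?M = "\<lambda>u. \<Sum>p\<in>haar_index N. a p * haar p u"
  have level: "(\<Sum>i<2 ^ (N - 1 - l). \<bar>a (l, i)\<bar> * (\<Sum>u<2 ^ N. \<bar>haar (l, i) u\<bar>))
      \<le> (\<Sum>u<2 ^ N. \<bar>?M u\<bar>)" if l: "l \<le> N" for l
  proof -
    let ?s = "\<lambda>i. sgn (a (l, i))"
    have coef: "(\<Sum>u<2 ^ N. ?M u * haar (l, i) u) = a (l, i) * (\<Sum>u<2 ^ N. \<bar>haar (l, i) u\<bar>)"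
      if i: "i < 2 ^ (N - 1 - l)" for i
    proof -
      have in_J: "(l, i) \<in> haar_index N" using l i by (simp add: haar_index_def)
      have "(\<Sum>u<2 ^ N. ?M u * haar (l, i) u)
          = (\<Sum>p\<in>haar_index N. a p * (\<Sum>u<2 ^ N. haar p u * haar (l, i) u))"
        unfolding sum_distrib_right sum_distrib_left
        by (subst sum.swap) (simp add: mult.assoc)
      also have "\<dots> = (\<Sum>p\<in>haar_index N. if p = (l, i) then
           a (l, i) * (\<Sum>u<2 ^ N. \<bar>haar (l, i) u\<bar>) else 0)"
      proof (intro sum.cong refl)
        fix p assume p: "p \<in> haar_index N"
        show "a p * (\<Sum>u<2 ^ N. haar p u * haar (l, i) u) = (if p = (l, i) then
           a (l, i) * (\<Sum>u<2 ^ N. \<bar>haar (l, i) u\<bar>) else 0)"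
        proof (cases "p = (l, i)")
          case True then show ?thesis by (simp add: haar_mult_self)
        next
          case False
          then show ?thesis using haar_orthogonal [of p "(l, i)" N] p l
            by (auto simp: haar_index_def)
        qed
      qed
      finally show ?thesis using in_J by simp
    qed
    have "(\<Sum>i<2 ^ (N - 1 - l). \<bar>a (l, i)\<bar> * (\<Sum>u<2 ^ N. \<bar>haar (l, i) u\<bar>))
        = (\<Sum>i<2 ^ (N - 1 - l). ?s i * (\<Sum>u<2 ^ N. ?M u * haar (l, i) u))"
      by (intro sum.cong refl, subst coef) (auto simp: sgn_if abs_if)
    also have "\<dots> = (\<Sum>u<2 ^ N. ?M u * (\<Sum>i<2 ^ (N - 1 - l). ?s i * haar (l, i) u))"
      unfolding sum_distrib_left by (subst sum.swap) (simp add: mult_ac)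
    also have "\<dots> \<le> (\<Sum>u<2 ^ N. \<bar>?M u\<bar>)"
    proof (intro sum_mono)
      fix u
      have "\<bar>\<Sum>i<2 ^ (N - 1 - l). ?s i * haar (l, i) u\<bar> \<le> 1"
        by (intro haar_level_le_1) (simp add: sgn_if)
      then have "\<bar>?M u\<bar> * \<bar>\<Sum>i<2 ^ (N - 1 - l). ?s i * haar (l, i) u\<bar> \<le> \<bar>?M u\<bar> * 1"
        by (intro mult_left_mono) auto
      then show "?M u * (\<Sum>i<2 ^ (N - 1 - l). ?s i * haar (l, i) u) \<le> \<bar>?M u\<bar>"
        by (simp add: abs_le_iff flip: abs_mult)
    qed
    finally show ?thesis .
  qed
  \<comment> \<open>The same bound holds for each of the \<open>N + 1\<close> levels; adding them up
    produces the factor \<open>real N + 1\<close>.\<close>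
  have "(\<Sum>p\<in>haar_index N. \<bar>a p\<bar> * (\<Sum>u<2 ^ N. \<bar>haar p u\<bar>))
      = (\<Sum>l\<le>N. \<Sum>i<2 ^ (N - 1 - l). \<bar>a (l, i)\<bar> * (\<Sum>u<2 ^ N. \<bar>haar (l, i) u\<bar>))"
    unfolding haar_index_def by (subst sum.Sigma) (auto simp: case_prod_beta)
  also have "\<dots> \<le> (\<Sum>l\<le>N. \<Sum>u<2 ^ N. \<bar>?M u\<bar>)"
    by (intro sum_mono level) simp
  finally show ?thesis by (simp add: algebra_simps)
qed

section \<open>The greedy potential\<close>

text \<open>The function \<open>y * sinh y - cosh y\<close> starts at -1 and has derivative
  \<open>y * cosh y\<close>, which is nonnegative for nonnegative \<open>y\<close>. The lemma makes
  the second-order coefficient of the potential smaller than the first-order one by a factor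
  \<open>x\<close>, later the rate.\<close>

lemma cosh_minus_1_le:
  fixes x :: real
  assumes "0 \<le> x"
  shows "cosh x - 1 \<le> x * sinh x"
proof -
  define f where "f y = y * sinh y - cosh y" for y :: real
  have "f 0 \<le> f x"
  proof (rule DERIV_nonneg_imp_nondecreasing [OF assms])
    fix y :: real assume "0 \<le> y" "y \<le> x"
    have "(f has_real_derivative y * cosh y) (at y)"
      unfolding f_def by (auto intro!: derivative_eq_intros)
    then show "\<exists>d. (f has_real_derivative d) (at y) \<and> 0 \<le> d"
      using \<open>0 \<le> y\<close> by (intro exI [of _ "y * cosh y"]) (auto simp: cosh_real_nonneg)
  qed
  then show ?thesis by (simp add: f_def)
qed

lemma cosh_le_2:
  fixes x :: real
  assumes "0 \<le> x" "x \<le> 1"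
  shows "cosh x \<le> 2"
proof -
  have "exp x \<le> 3" using assms exp_le by (meson exp_le_cancel_iff order_trans)
  moreover have "exp (- x) \<le> 1" using assms by simp
  ultimately show ?thesis unfolding cosh_def scaleR_conv_of_real by (simp del: exp_le_one_iff)
qed

text \<open>Since \<open>h\<close> is -1, 0 or 1 and \<open>c\<close> is a sign, the addition
  formula gives an exact identity without Taylor remainder, and only the last term depends on
  \<open>c\<close>.\<close>

lemma cosh_step:
  fixes c d h \<theta> :: real
  assumes "c = 1 \<or> c = -1" "h = -1 \<or> h = 0 \<or> h = 1"
  shows "cosh (\<theta> * (d + c * h)) = cosh (\<theta> * d) + (cosh \<theta> - 1) * (\<bar>h\<bar> * cosh (\<theta> * d))
           + sinh \<theta> * (c * (sinh (\<theta> * d) * h))"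
  using assms by (auto simp: algebra_simps cosh_add cosh_diff)

lemma cosh_le_1_abs_sinh: "cosh (x::real) \<le> 1 + \<bar>sinh x\<bar>"
proof -
  have "(cosh x)\<^sup>2 \<le> (1 + \<bar>sinh x\<bar>)\<^sup>2"
    using cosh_square_eq [of x] by (simp add: power2_sum)
  then show ?thesis by (rule power2_le_imp_le) simp
qed

text \<open>There are \<open>N + 1\<close> levels; this rate cancels the factor lost in
  \<open>haar_sum_l1_lower_bound\<close>.\<close>

definition rate :: "nat \<Rightarrow> real" where "rate N = 1 / (real N + 1)"

definition potential :: "nat \<Rightarrow> (nat \<times> nat \<Rightarrow> real) \<Rightarrow> real" where
  "potential N d = (\<Sum>p\<in>haar_index N. cosh (rate N * d p))"

text \<open>By \<open>cosh_step\<close> the sign affects the next potential only through its product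
  with this sum, so opposing the sum minimises the next potential exactly. Ties go to -1.\<close>

definition greedy_sign :: "nat \<Rightarrow> (nat \<times> nat \<Rightarrow> real) \<Rightarrow> nat \<Rightarrow> real" where
  "greedy_sign N d u =
     (if (\<Sum>p\<in>haar_index N. sinh (rate N * d p) * haar p u) \<ge> 0 then - 1 else 1)"

lemma greedy_sign_cases: "greedy_sign N d u = 1 \<or> greedy_sign N d u = -1"
  by (simp add: greedy_sign_def)

text \<open>The sum over \<open>u\<close> is \<open>2 ^ N\<close> times the expectation over a
  uniform cell. The greedy sign gains \<open>sinh (rate N)\<close> times the L1 norm of
  \<open>M\<close>, which pays for the part of the second-order term that grows with the
  state.\<close>

lemma potential_greedy_step:
  "(\<Sum>u<2 ^ N. potential N (\<lambda>p. d p + greedy_sign N d u * haar p u))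
     \<le> 2 ^ N * (potential N d + real (card (haar_index N)))"
proof -
  let ?\<theta> = "rate N" and ?J = "haar_index N"
  define S where "S p = (\<Sum>u<2 ^ N. \<bar>haar p u\<bar>)" for p
  define M where "M u = (\<Sum>p\<in>?J. sinh (?\<theta> * d p) * haar p u)" for u
  have \<theta>: "0 \<le> ?\<theta>" "?\<theta> \<le> 1" by (auto simp: rate_def)
  have S: "0 \<le> S p" "S p \<le> 2 ^ N" for p
  proof -
    show "0 \<le> S p" by (auto simp: S_def intro: sum_nonneg)
    have "S p \<le> (\<Sum>u<(2::nat) ^ N. 1)" unfolding S_def by (intro sum_mono abs_haar_le)
    then show "S p \<le> 2 ^ N" by simp
  qed
  have sgn: "greedy_sign N d u * M u = - \<bar>M u\<bar>" for u
    by (auto simp: greedy_sign_def M_def)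
  have "(\<Sum>u<2 ^ N. potential N (\<lambda>p. d p + greedy_sign N d u * haar p u))
      = (\<Sum>u<2 ^ N. potential N d + (cosh ?\<theta> - 1) * (\<Sum>p\<in>?J. \<bar>haar p u\<bar> * cosh (?\<theta> * d p))
          + sinh ?\<theta> * (greedy_sign N d u * M u))"
    unfolding potential_def M_def
    by (simp add: cosh_step [OF greedy_sign_cases haar_cases] sum.distrib sum_distrib_left)
  also have "\<dots> = 2 ^ N * potential N d
      + (cosh ?\<theta> - 1) * (\<Sum>u<2 ^ N. \<Sum>p\<in>?J. \<bar>haar p u\<bar> * cosh (?\<theta> * d p))
      - sinh ?\<theta> * (\<Sum>u<2 ^ N. \<bar>M u\<bar>)"
    unfolding sgn by (simp add: sum.distrib sum_subtractf flip: sum_distrib_left)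
  also have "(\<Sum>u<2 ^ N. \<Sum>p\<in>?J. \<bar>haar p u\<bar> * cosh (?\<theta> * d p)) = (\<Sum>p\<in>?J. S p * cosh (?\<theta> * d p))"
    unfolding S_def sum_distrib_right by (rule sum.swap)
  also have "(cosh ?\<theta> - 1) * (\<Sum>p\<in>?J. S p * cosh (?\<theta> * d p))
      \<le> (cosh ?\<theta> - 1) * (\<Sum>p\<in>?J. S p) + sinh ?\<theta> * (\<Sum>u<2 ^ N. \<bar>M u\<bar>)"
  proof -
    \<comment> \<open>Here \<open>cosh\<close> is split: the summand 1 becomes the additive loss,
      while the \<open>sinh\<close> part consists of the coefficients of \<open>M\<close> and is
      absorbed by the gain.\<close>
    have "(\<Sum>p\<in>?J. S p * cosh (?\<theta> * d p)) \<le> (\<Sum>p\<in>?J. S p * (1 + \<bar>sinh (?\<theta> * d p)\<bar>))"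
      by (intro sum_mono mult_left_mono cosh_le_1_abs_sinh S)
    also have "\<dots> = (\<Sum>p\<in>?J. S p) + (\<Sum>p\<in>?J. \<bar>sinh (?\<theta> * d p)\<bar> * S p)"
      by (simp add: algebra_simps sum.distrib)
    finally have 1: "(cosh ?\<theta> - 1) * (\<Sum>p\<in>?J. S p * cosh (?\<theta> * d p))
        \<le> (cosh ?\<theta> - 1) * (\<Sum>p\<in>?J. S p) + (cosh ?\<theta> - 1) * (\<Sum>p\<in>?J. \<bar>sinh (?\<theta> * d p)\<bar> * S p)"
      by (simp add: mult_left_mono cosh_real_ge_1 flip: distrib_left)
    have nonneg: "0 \<le> (\<Sum>p\<in>?J. \<bar>sinh (?\<theta> * d p)\<bar> * S p)"
      using S by (intro sum_nonneg) auto
    have "(cosh ?\<theta> - 1) * (\<Sum>p\<in>?J. \<bar>sinh (?\<theta> * d p)\<bar> * S p)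
        \<le> (?\<theta> * sinh ?\<theta>) * (\<Sum>p\<in>?J. \<bar>sinh (?\<theta> * d p)\<bar> * S p)"
      by (intro mult_right_mono cosh_minus_1_le \<theta> nonneg)
    also have "\<dots> \<le> (?\<theta> * sinh ?\<theta>) * ((real N + 1) * (\<Sum>u<2 ^ N. \<bar>M u\<bar>))"
      using haar_sum_l1_lower_bound [of "\<lambda>p. sinh (?\<theta> * d p)" N] \<theta>
      by (intro mult_left_mono) (auto simp: S_def M_def)
    also have "\<dots> = sinh ?\<theta> * (\<Sum>u<2 ^ N. \<bar>M u\<bar>)"
      by (simp add: rate_def field_simps)
    finally show ?thesis using 1 by linarith
  qed
  \<comment> \<open>The rate is at most 1, so \<open>cosh ?\<theta> - 1\<close> is at most 1: on
    average each Haar function costs at most one unit per step.\<close>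
  also have "(cosh ?\<theta> - 1) * (\<Sum>p\<in>?J. S p) \<le> 1 * (\<Sum>p\<in>?J. 2 ^ N)"
    using cosh_le_2 [OF \<theta>] S by (intro mult_mono sum_mono sum_nonneg) auto
  finally show ?thesis by (simp add: algebra_simps)
qed

section \<open>From Haar sums to dyadic blocks, prefixes and intervals\<close>

text \<open>Descending induction from the whole range, which the constant function
  \<open>(N, 0)\<close> controls. The parent block is the sum of its two halves and the Haar sum is
  their difference, so each half is an average of two quantities bounded by \<open>B\<close>:
  nothing is lost from level to level.\<close>

lemma abs_dyadic_block_le:
  fixes \<sigma> :: "nat \<Rightarrow> real" and z :: "nat \<Rightarrow> nat"
  assumes z: "\<And>s. z s < 2 ^ N"
    and B: "\<And>p. p \<in> haar_index N \<Longrightarrow> \<bar>\<Sum>s\<in>S. \<sigma> s * haar p (z s)\<bar> \<le> B"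
    and l: "l \<le> N" and i: "i < 2 ^ (N - l)"
  shows "\<bar>\<Sum>s\<in>S. \<sigma> s * of_bool (z s div 2 ^ l = i)\<bar> \<le> B"
  using l i
proof (induction arbitrary: i rule: inc_induct)
  case base
  have "haar (N, 0) (z s) = 1" for s
    using z [of s] by (simp add: haar_def)
  then show ?case using base B [of "(N, 0)"] z by (simp add: haar_index_def)
next
  case (step l)
  let ?D = "\<lambda>l i. \<Sum>s\<in>S. \<sigma> s * of_bool (z s div 2 ^ l = i)"
  define m where "m = i div 2"
  have "N - l = Suc (N - Suc l)" using step by simp
  then have m: "m < 2 ^ (N - Suc l)" using step.prems by (simp add: m_def less_mult_imp_div_less mult.commute)
  have IH: "\<bar>?D (Suc l) m\<bar> \<le> B" using step.IH [OF m] .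
  have H: "\<bar>\<Sum>s\<in>S. \<sigma> s * haar (l, m) (z s)\<bar> \<le> B"
    using m step by (intro B) (auto simp: haar_index_def)
  have sum: "?D (Suc l) m = ?D l (2 * m) + ?D l (2 * m + 1)"
    unfolding sum.distrib [symmetric] div_pow_Suc
    by (intro sum.cong refl) (auto simp: of_bool_def)
  have diff: "(\<Sum>s\<in>S. \<sigma> s * haar (l, m) (z s)) = ?D l (2 * m) - ?D l (2 * m + 1)"
    unfolding sum_subtractf [symmetric] haar_def div_pow_Suc fst_conv snd_conv
    by (intro sum.cong refl) (auto simp: of_bool_def)
  have "i = 2 * m \<or> i = 2 * m + 1" by (auto simp: m_def)
  then show ?case using IH H unfolding sum diff by (auto simp: abs_le_iff)
qed

text \<open>A prefix of \<open>m\<close> blocks is a prefix of \<open>m div 2\<close> parent blocks,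
  plus one more block if \<open>m\<close> is odd. Each level therefore costs at most one
  \<open>B\<close>.\<close>

lemma abs_dyadic_prefix_le:
  fixes \<sigma> :: "nat \<Rightarrow> real" and z :: "nat \<Rightarrow> nat"
  assumes z: "\<And>s. z s < 2 ^ N"
    and B: "\<And>p. p \<in> haar_index N \<Longrightarrow> \<bar>\<Sum>s\<in>S. \<sigma> s * haar p (z s)\<bar> \<le> B"
    and l: "l \<le> N" and m: "m \<le> 2 ^ (N - l)"
  shows "\<bar>\<Sum>s\<in>S. \<sigma> s * of_bool (z s div 2 ^ l < m)\<bar> \<le> (real (N - l) + 1) * B"
  using l m
proof (induction arbitrary: m rule: inc_induct)
  case base
  have B0: "0 \<le> B" using B [of "(N, 0)"] by (force simp: haar_index_def)
  have "m = 0 \<or> m = 1" using base by auto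
  then show ?case using abs_dyadic_block_le [where S = S and \<sigma> = \<sigma> and z = z and N = N and B = B and l = N and i = 0, OF z B] B0 by auto
next
  case (step l)
  have B0: "0 \<le> B" using B [of "(N, 0)"] by (force simp: haar_index_def)
  let ?F = "\<lambda>l m. \<Sum>s\<in>S. \<sigma> s * of_bool (z s div 2 ^ l < m)"
  define k where "k = m div 2"
  have Nl: "N - l = Suc (N - Suc l)" using step by simp
  then have k: "k \<le> 2 ^ (N - Suc l)" using step.prems by (simp add: k_def)
  have IH: "\<bar>?F (Suc l) k\<bar> \<le> (real (N - Suc l) + 1) * B" by (rule step.IH [OF k])
  show ?case
  proof (cases "even m")
    case True
    then have "m = 2 * k" by (simp add: k_def)
    then have "?F l m = ?F (Suc l) k"
      unfolding div_pow_Suc by (intro sum.cong refl) auto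
    also have "\<bar>\<dots>\<bar> \<le> (real (N - l) + 1) * B"
      using IH B0 by (simp add: Nl algebra_simps)
    finally show ?thesis .
  next
    case False
    then have mk: "m = 2 * k + 1" by (auto simp: k_def)
    have "?F l m = ?F (Suc l) k + (\<Sum>s\<in>S. \<sigma> s * of_bool (z s div 2 ^ l = 2 * k))"
      unfolding div_pow_Suc sum.distrib [symmetric]
      by (intro sum.cong refl) (auto simp: mk of_bool_def)
    moreover have "\<bar>\<Sum>s\<in>S. \<sigma> s * of_bool (z s div 2 ^ l = 2 * k)\<bar> \<le> B"
      using step mk by (intro abs_dyadic_block_le [OF z B]) auto
    ultimately show ?thesis using IH by (simp add: Nl algebra_simps)
  qed
qed

text \<open>The cap puts the endpoint 1 into the last cell, and \<open>nat\<close> sends negative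
  arguments to cell 0. The map is thus monotone with range \<open>{..<2 ^ N}\<close> on all reals,
  without side conditions.\<close>

definition cell :: "nat \<Rightarrow> real \<Rightarrow> nat" where
  "cell N x = min (nat \<lfloor>2 ^ N * x\<rfloor>) (2 ^ N - 1)"

lemma cell_less [simp]: "cell N x < 2 ^ N"
  unfolding cell_def by (rule le_less_trans [OF min.cobounded2]) simp

lemma cell_mono: "x \<le> y \<Longrightarrow> cell N x \<le> cell N y"
  unfolding cell_def by (intro min.mono nat_mono floor_mono mult_left_mono) auto

text \<open>The leftmost and the rightmost sample point of the interval determine its trace by
  convexity. This treats open, closed and half-open intervals alike.\<close>

lemma interval_trace:
  fixes x :: "nat \<Rightarrow> real"
  assumes "finite S" "is_interval I" "\<exists>s\<in>S. x s \<in> I"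
  obtains i j where "i \<in> S" "j \<in> S" "x i \<in> I" "x j \<in> I"
    "\<And>s. s \<in> S \<Longrightarrow> x s \<in> I \<longleftrightarrow> x i \<le> x s \<and> x s \<le> x j"
proof -
  define A where "A = x ` {s \<in> S. x s \<in> I}"
  have A: "finite A" "A \<noteq> {}" using assms by (auto simp: A_def)
  obtain i where i: "i \<in> S" "x i \<in> I" "x i = Min A"
    using Min_in [OF A] by (auto simp: A_def)
  obtain j where j: "j \<in> S" "x j \<in> I" "x j = Max A"
    using Max_in [OF A] by (auto simp: A_def)
  have *: "x s \<in> I \<longleftrightarrow> x i \<le> x s \<and> x s \<le> x j" if "s \<in> S" for s
  proof
    assume "x s \<in> I"
    then have "x s \<in> A" using that by (simp add: A_def)
    then show "x i \<le> x s \<and> x s \<le> x j" using A i j by simp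
  next
    assume "x i \<le> x s \<and> x s \<le> x j"
    then show "x s \<in> I" using assms(2) i(2) j(2) unfolding is_interval_1 by blast
  qed
  show thesis by (rule that [OF i(1) j(1) i(2) j(2) *])
qed

text \<open>The cells strictly between those of the two extreme points lie inside the interval and
  form a difference of two prefixes. Only points in the two extreme cells can be miscounted.\<close>

lemma disc_interval_le:
  fixes \<sigma> x :: "nat \<Rightarrow> real"
  assumes \<sigma>: "\<And>s. \<bar>\<sigma> s\<bar> \<le> 1"
    and B: "\<And>p. p \<in> haar_index N \<Longrightarrow> \<bar>\<Sum>s=1..t. \<sigma> s * haar p (cell N (x s))\<bar> \<le> B"
    and C: "\<And>u. u < 2 ^ N \<Longrightarrow> (\<Sum>s=1..t. of_bool (cell N (x s) = u)) \<le> C"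
    and I: "is_interval I"
  shows "disc \<sigma> x t I \<le> 2 * (real N + 1) * B + 2 * C"
proof (cases "\<exists>s\<in>{1..t}. x s \<in> I")
  case False
  have B0: "0 \<le> B" using B [of "(N, 0)"] by (force simp: haar_index_def)
  have C0: "0 \<le> C" by (rule order_trans [OF sum_nonneg C [of 0]]) auto
  have "disc \<sigma> x t I = 0" using False by (simp add: disc_def)
  then show ?thesis using B0 C0 by simp
next
  case True
  then obtain i j where ij: "i \<in> {1..t}" "j \<in> {1..t}" "x i \<in> I" "x j \<in> I"
    and tr: "\<And>s. s \<in> {1..t} \<Longrightarrow> x s \<in> I \<longleftrightarrow> x i \<le> x s \<and> x s \<le> x j"
    using interval_trace [OF _ I, where S = "{1..t}" and x = x] by auto
  let ?z = "\<lambda>s. cell N (x s)"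
  let ?F = "\<lambda>m. \<Sum>s=1..t. \<sigma> s * of_bool (?z s < m)"
  \<comment> \<open>If both extreme points share a cell, the difference of prefixes is minus the
    indicator of that cell. The error there is at most 2, and the bound below counts this cell
    twice.\<close>
  define e where "e s = \<sigma> s * indicator I (x s) - (\<sigma> s * of_bool (?z s < ?z j)
      - \<sigma> s * of_bool (?z s < ?z i + 1))" for s
  have F: "\<bar>?F m\<bar> \<le> (real N + 1) * B" if "m \<le> 2 ^ N" for m
    using abs_dyadic_prefix_le [where z = ?z and N = N and S = "{1..t}" and \<sigma> = \<sigma> and B = B and l = 0 and m = m] B that by simp
  have e: "\<bar>e s\<bar> \<le> of_bool (?z s = ?z i) + of_bool (?z s = ?z j)" if s: "s \<in> {1..t}" for s
  proof -
    have in1: "?z i \<le> ?z s \<and> ?z s \<le> ?z j" if "x s \<in> I"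
      using tr [OF s] that by (auto intro: cell_mono)
    have in2: "x s \<in> I" if "?z i < ?z s" "?z s < ?z j"
      using tr [OF s] that by (meson cell_mono leD linear)
    have ij': "?z i \<le> ?z j" using tr [of i] ij by (auto intro: cell_mono)
    have "e s = \<sigma> s * (indicator I (x s) - of_bool (?z s < ?z j) + of_bool (?z s < ?z i + 1))"
      by (simp add: e_def algebra_simps)
    also have "\<bar>\<dots>\<bar> \<le> 1 * \<bar>indicator I (x s) - of_bool (?z s < ?z j) + of_bool (?z s < ?z i + 1)\<bar>"
      unfolding abs_mult by (intro mult_right_mono \<sigma>) auto
    also have "\<dots> \<le> of_bool (?z s = ?z i) + of_bool (?z s = ?z j)"
      using in1 in2 ij' by (cases "x s \<in> I"; cases "?z i < ?z s"; cases "?z s < ?z j") auto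
    finally show ?thesis .
  qed
  have "(\<Sum>s=1..t. \<sigma> s * indicator I (x s)) = ?F (?z j) - ?F (?z i + 1) + (\<Sum>s=1..t. e s)"
    unfolding e_def sum_subtractf by linarith
  moreover have "\<bar>\<Sum>s=1..t. e s\<bar> \<le> C + C"
  proof -
    have "\<bar>\<Sum>s=1..t. e s\<bar> \<le> (\<Sum>s=1..t. of_bool (?z s = ?z i) + of_bool (?z s = ?z j))"
      by (rule order_trans [OF sum_abs sum_mono]) (rule e)
    also have "\<dots> \<le> C + C"
      unfolding sum.distrib by (intro add_mono C) auto
    finally show ?thesis .
  qed
  moreover have "\<bar>?F (?z j)\<bar> \<le> (real N + 1) * B" "\<bar>?F (?z i + 1)\<bar> \<le> (real N + 1) * B"
    using cell_less [of N "x i"] cell_less [of N "x j"] by (intro F; linarith)+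
  ultimately show ?thesis unfolding disc_def by linarith
qed

section \<open>Random cells and expected potential\<close>

abbreviation unif :: "real measure" where
  "unif \<equiv> uniform_measure lborel {0..1}"

lemma prob_space_unif: "prob_space unif"
  by (rule prob_space_uniform_measure) auto

lemma prob_space_points: "prob_space (points T)"
  unfolding points_def by (intro prob_space_PiM prob_space_unif)

lemma sets_points: "sets (points T) = sets (PiM {1..T} (\<lambda>_. borel))"
  unfolding points_def by (intro sets_PiM_cong) auto

lemma measurable_points: "measurable (points T) = measurable (PiM {1..T} (\<lambda>_. borel))"
  using measurable_cong_sets [OF sets_points] by blast

lemma measurable_cell [measurable]: "cell N \<in> borel \<rightarrow>\<^sub>M count_space UNIV"
proof -
  have "(\<lambda>x::real. \<lfloor>2 ^ N * x\<rfloor>) \<in> borel \<rightarrow>\<^sub>M count_space UNIV"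
    by measurable
  from measurable_compose [OF this, of "\<lambda>k. min (nat k) (2 ^ N - 1)" "count_space UNIV"]
  show ?thesis unfolding cell_def by simp
qed

lemma measurable_cell_borel [measurable]: "(\<lambda>x. (f (cell N x) :: real)) \<in> borel_measurable borel"
  by (rule measurable_compose [OF measurable_cell]) simp

lemma measurable_cell_component:
  fixes f :: "nat \<Rightarrow> real"
  assumes "s \<in> I"
  shows "(\<lambda>x. f (cell N (x s))) \<in> borel_measurable (PiM I (\<lambda>_. borel))"
proof -
  have "(\<lambda>x. x s) \<in> PiM I (\<lambda>_. borel) \<rightarrow>\<^sub>M (borel :: real measure)"
    by (rule measurable_component_singleton [OF assms])
  from measurable_compose [OF this, of "\<lambda>y. f (cell N y)" borel]
  show ?thesis by simp
qed

lemma measure_unif_cell: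
  assumes u: "u < 2 ^ N"
  shows "measure unif {x. cell N x = u} = 1 / 2 ^ N"
proof -
  have meas: "{x. cell N x = u} \<in> sets lborel"
    using measurable_sets [OF measurable_cell, of "{u}" N] by (simp add: vimage_def)
  have "measure lborel ({0..1} \<inter> {x. cell N x = u}) = 1 / 2 ^ N"
  proof (cases "u + 1 < 2 ^ N")
    case True
    then have u': "real u + 1 < 2 ^ N"
      using of_nat_less_iff [of "u + 1" "2 ^ N", where 'a = real] by simp
    have "(0 \<le> x \<and> x \<le> 1) \<and> cell N x = u \<longleftrightarrow> real u / 2 ^ N \<le> x \<and> x < (real u + 1) / 2 ^ N" for x
    proof -
      have "cell N x = u \<longleftrightarrow> nat \<lfloor>2 ^ N * x\<rfloor> = u"
        using True by (auto simp: cell_def min_def)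
      also have "\<dots> \<longleftrightarrow> \<lfloor>2 ^ N * x\<rfloor> = int u" if "0 \<le> x"
        using that by (simp add: nat_eq_iff)
      finally have *: "cell N x = u \<longleftrightarrow> real u \<le> 2 ^ N * x \<and> 2 ^ N * x < real u + 1" if "0 \<le> x"
        using that by (simp add: floor_eq_iff)
      have "0 \<le> x \<and> x \<le> 1" if "real u / 2 ^ N \<le> x" "x < (real u + 1) / 2 ^ N"
      proof -
        have "0 \<le> real u / 2 ^ N" by simp
        moreover have "(real u + 1) / 2 ^ N \<le> 1" using u' by simp
        ultimately show ?thesis using that by linarith
      qed
      then show ?thesis using * by (auto simp: field_simps)
    qed
    then have "{0..1} \<inter> {x. cell N x = u} = {real u / 2 ^ N ..< (real u + 1) / 2 ^ N}"
      by (simp only: set_eq_iff Int_iff mem_Collect_eq atLeastLessThan_iff atLeastAtMost_iff simp_thms)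
    then show ?thesis by (simp add: divide_right_mono add_divide_distrib)
  next
    case False
    \<comment> \<open>The last cell contains 1 and is closed on the right; its length is the same as
      that of the others.\<close>
    then have u2: "u = 2 ^ N - 1" using u by simp
    then have u': "real u = 2 ^ N - 1" by (simp add: of_nat_diff)
    have "(0 \<le> x \<and> x \<le> 1) \<and> cell N x = u \<longleftrightarrow> real u / 2 ^ N \<le> x \<and> x \<le> 1" for x
    proof -
      have "cell N x = u \<longleftrightarrow> u \<le> nat \<lfloor>2 ^ N * x\<rfloor>"
        by (auto simp: cell_def u2 min_def)
      also have "\<dots> \<longleftrightarrow> real u \<le> 2 ^ N * x" if "0 \<le> x"
        using that by (simp add: le_nat_iff le_floor_iff)
      finally have "cell N x = u \<longleftrightarrow> real u / 2 ^ N \<le> x" if "0 \<le> x"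
        using that by (simp add: field_simps)
      moreover have "0 \<le> x" if "real u / 2 ^ N \<le> x"
        using that by (meson divide_nonneg_nonneg of_nat_0_le_iff order_trans zero_le_numeral zero_le_power)
      ultimately show ?thesis by auto
    qed
    then have "{0..1} \<inter> {x. cell N x = u} = {real u / 2 ^ N .. 1}"
      by (simp only: set_eq_iff Int_iff mem_Collect_eq atLeastLessThan_iff atLeastAtMost_iff simp_thms)
    moreover have "real u / 2 ^ N \<le> 1" by (simp add: u')
    ultimately show ?thesis by (simp add: u' field_simps)
  qed
  then show ?thesis using meas by (subst measure_uniform_measure) auto
qed

lemma
  fixes f :: "nat \<Rightarrow> real"
  shows integrable_cell: "integrable unif (\<lambda>x. f (cell N x))"
    and integral_cell: "(\<integral>x. f (cell N x) \<partial>unif) = (\<Sum>u<2 ^ N. f u) / 2 ^ N"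
proof -
  interpret prob_space unif by (rule prob_space_unif)
  have meas: "{x. cell N x = u} \<in> sets unif" for u
    using measurable_sets [OF measurable_cell, of "{u}" N] by (simp add: vimage_def)
  have eq: "f (cell N x) = (\<Sum>u<2 ^ N. f u * indicator {x. cell N x = u} x)" for x
  proof -
    have "(\<Sum>u<2 ^ N. f u * indicator {x. cell N x = u} x) = (\<Sum>u<2 ^ N. if u = cell N x then f u else 0)"
      by (intro sum.cong) (auto simp: indicator_def)
    then show ?thesis by simp
  qed
  have int: "integrable unif (\<lambda>x. f u * indicator {x. cell N x = u} x)" for u
    using meas [of u] by (intro integrable_mult_right integrable_real_indicator) (auto simp: emeasure_eq_measure)
  show "integrable unif (\<lambda>x. f (cell N x))"
    unfolding eq by (intro Bochner_Integration.integrable_sum int)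
  show "(\<integral>x. f (cell N x) \<partial>unif) = (\<Sum>u<2 ^ N. f u) / 2 ^ N"
    unfolding eq using int meas
    by (subst Bochner_Integration.integral_sum) (auto simp: measure_unif_cell sum_divide_distrib simp del: measure_uniform_measure)
qed

lemma nn_integral_cell:
  fixes f :: "nat \<Rightarrow> real"
  assumes "\<And>u. 0 \<le> f u"
  shows "(\<integral>\<^sup>+x. ennreal (f (cell N x)) \<partial>unif) = ennreal ((\<Sum>u<2 ^ N. f u) / 2 ^ N)"
  using assms by (subst nn_integral_eq_integral) (auto simp: integrable_cell integral_cell)

text \<open>Integrating coordinate \<open>i\<close> first turns a comparison of conditional
  expectations, with all other coordinates frozen, into one of expectations. It replaces
  conditioning on the past in both inductions over time below.\<close>

lemma nn_integral_PiM_mono_coordinate: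
  assumes M: "prob_space M" and I: "finite I" "i \<in> I"
    and f: "f \<in> borel_measurable (PiM I (\<lambda>_. M))" and g: "g \<in> borel_measurable (PiM I (\<lambda>_. M))"
    and le: "\<And>x. (\<integral>\<^sup>+y. f (x(i := y)) \<partial>M) \<le> (\<integral>\<^sup>+y. g (x(i := y)) \<partial>M)"
  shows "(\<integral>\<^sup>+x. f x \<partial>PiM I (\<lambda>_. M)) \<le> (\<integral>\<^sup>+x. g x \<partial>PiM I (\<lambda>_. M))"
proof -
  interpret prob_space M by (rule M)
  interpret product_sigma_finite "\<lambda>_. M" ..
  have ins: "I = insert i (I - {i})" using I by auto
  have *: "(\<integral>\<^sup>+x. h x \<partial>PiM I (\<lambda>_. M)) = (\<integral>\<^sup>+x. (\<integral>\<^sup>+y. h (x(i := y)) \<partial>M) \<partial>PiM (I - {i}) (\<lambda>_. M))"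
    if "h \<in> borel_measurable (PiM I (\<lambda>_. M))" for h
    using that I by (subst ins, subst product_nn_integral_insert) (auto simp: insert_absorb)
  show ?thesis unfolding * [OF f] * [OF g] by (intro nn_integral_mono le)
qed

section \<open>The greedy signing as an online algorithm\<close>

fun greedy_state :: "nat \<Rightarrow> (nat \<Rightarrow> nat) \<Rightarrow> nat \<Rightarrow> nat \<times> nat \<Rightarrow> real" where
  "greedy_state N z 0 = (\<lambda>p. 0)"
| "greedy_state N z (Suc t) = (\<lambda>p. greedy_state N z t p
     + greedy_sign N (greedy_state N z t) (z (Suc t)) * haar p (z (Suc t)))"

definition greedy :: "nat \<Rightarrow> (nat \<Rightarrow> nat) \<Rightarrow> nat \<Rightarrow> real" where
  "greedy N z t = greedy_sign N (greedy_state N z (t - 1)) (z t)"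

lemma greedy_state_cong:
  "(\<And>s. 1 \<le> s \<Longrightarrow> s \<le> t \<Longrightarrow> z s = z' s) \<Longrightarrow> greedy_state N z t = greedy_state N z' t"
  by (induction t) auto

lemma greedy_state_eq_sum: "greedy_state N z t p = (\<Sum>s=1..t. greedy N z s * haar p (z s))"
  by (induction t) (auto simp: greedy_def)

lemma greedy_state_measurable:
  assumes "{1..t} \<subseteq> I"
  shows "(\<lambda>x. greedy_state N (\<lambda>s. cell N (x s)) t p) \<in> borel_measurable (PiM I (\<lambda>_. borel))"
  using assms
proof (induction t arbitrary: p)
  case (Suc t)
  have [measurable]: "(\<lambda>x. greedy_state N (\<lambda>s. cell N (x s)) t p) \<in> borel_measurable (PiM I (\<lambda>_. borel))" for p
    by (rule Suc.IH, rule order_trans [OF _ Suc.prems]) auto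
  have [measurable]: "(\<lambda>x. haar p (cell N (x (Suc t)))) \<in> borel_measurable (PiM I (\<lambda>_. borel))" for p
    using Suc.prems by (intro measurable_cell_component) auto
  show ?case unfolding greedy_state.simps greedy_sign_def sinh_def by measurable
qed simp

lemma greedy_measurable:
  assumes "{1..t} \<subseteq> I" "1 \<le> t"
  shows "(\<lambda>x. greedy N (\<lambda>s. cell N (x s)) t) \<in> borel_measurable (PiM I (\<lambda>_. borel))"
proof -
  have [measurable]: "(\<lambda>x. greedy_state N (\<lambda>s. cell N (x s)) (t - 1) p) \<in> borel_measurable (PiM I (\<lambda>_. borel))" for p
    by (intro greedy_state_measurable order_trans [OF _ assms(1)]) auto
  have [measurable]: "(\<lambda>x. haar p (cell N (x t))) \<in> borel_measurable (PiM I (\<lambda>_. borel))" for p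
    using assms by (intro measurable_cell_component) auto
  show ?thesis unfolding greedy_def greedy_sign_def sinh_def by measurable
qed

lemma greedy_cases: "greedy N z t = 1 \<or> greedy N z t = -1"
  unfolding greedy_def by (rule greedy_sign_cases)

definition greedy_algorithm :: "nat \<Rightarrow> nat \<Rightarrow> (nat \<Rightarrow> real) \<Rightarrow> real" where
  "greedy_algorithm N t x = greedy N (\<lambda>s. cell N (x s)) t"

lemma online_greedy_algorithm: "online_algorithm T (greedy_algorithm N)"
  unfolding online_algorithm_def
proof
  fix t assume t: "t \<in> {1..T}"
  have *: "greedy_algorithm N t \<in> borel_measurable (PiM {1..t} (\<lambda>_. borel))"
    unfolding greedy_algorithm_def using t by (intro greedy_measurable) auto
  show "greedy_algorithm N t \<in> PiM {1..t} (\<lambda>_. borel) \<rightarrow>\<^sub>M count_space {-1, 1}"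
    unfolding measurable_count_space_eq2 [OF finite.insertI [OF finite.insertI [OF finite.emptyI]]]
  proof (intro conjI ballI)
    show "greedy_algorithm N t \<in> space (PiM {1..t} (\<lambda>_. borel)) \<rightarrow> {-1, 1}"
      unfolding greedy_algorithm_def Pi_iff insert_iff empty_iff using greedy_cases by blast
    fix a :: real
    show "greedy_algorithm N t -` {a} \<inter> space (PiM {1..t} (\<lambda>_. borel)) \<in> sets (PiM {1..t} (\<lambda>_. borel))"
      by (rule measurable_sets [OF *]) simp
  qed
qed

text \<open>The greedy sign at time \<open>t\<close> reads the points up to \<open>t\<close> only,
  so the truncation inside \<open>signing\<close> does not change it.\<close>

lemma signing_greedy_algorithm:
  assumes "1 \<le> t"
  shows "signing (greedy_algorithm N) x t = greedy N (\<lambda>s. cell N (x s)) t"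
proof -
  have "greedy_state N (\<lambda>s. cell N (restrict x {1..t} s)) (t - 1) = greedy_state N (\<lambda>s. cell N (x s)) (t - 1)"
    by (rule greedy_state_cong) auto
  then show ?thesis
    using assms by (simp add: signing_def greedy_algorithm_def greedy_def)
qed

lemma potential_nonneg: "0 \<le> potential N d"
  unfolding potential_def by (intro sum_nonneg) simp

lemma potential_measurable:
  assumes "t \<le> T"
  shows "(\<lambda>x. potential N (greedy_state N (\<lambda>s. cell N (x s)) t)) \<in> borel_measurable (points T)"
proof -
  have [measurable]: "(\<lambda>x. greedy_state N (\<lambda>s. cell N (x s)) t p) \<in> borel_measurable (points T)" for p
    unfolding measurable_points using assms by (intro greedy_state_measurable) auto
  show ?thesis unfolding potential_def cosh_def by measurable
qed

text \<open>Initially every \<open>cosh\<close> is 1, which gives the cardinality of the index set;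
  by \<open>potential_greedy_step\<close> each new point adds at most this amount again in
  expectation.\<close>

lemma nn_integral_potential_le:
  assumes "t \<le> T"
  shows "(\<integral>\<^sup>+x. ennreal (potential N (greedy_state N (\<lambda>s. cell N (x s)) t)) \<partial>points T)
      \<le> ennreal (real (card (haar_index N)) * (1 + real t))"
  using assms
proof (induction t)
  case 0
  interpret prob_space "points T" by (rule prob_space_points)
  show ?case by (simp add: potential_def emeasure_space_1)
next
  case (Suc t)
  interpret prob_space "points T" by (rule prob_space_points)
  let ?c = "real (card (haar_index N))"
  let ?P = "\<lambda>t x. ennreal (potential N (greedy_state N (\<lambda>s. cell N (x s)) t))"
  have meas: "?P t \<in> borel_measurable (points T)" if "t \<le> T" for t
    using potential_measurable [OF that] by simp
  have "(\<integral>\<^sup>+x. ?P (Suc t) x \<partial>points T) \<le> (\<integral>\<^sup>+x. ?P t x + ennreal ?c \<partial>points T)"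
    unfolding points_def
  proof (rule nn_integral_PiM_mono_coordinate [OF prob_space_unif, where i = "Suc t"])
    show "Suc t \<in> {1..T}" using Suc.prems by simp
    show "?P (Suc t) \<in> borel_measurable (PiM {1..T} (\<lambda>_. unif))"
      using meas [of "Suc t"] Suc.prems unfolding points_def by (simp del: greedy_state.simps)
    show "(\<lambda>x. ?P t x + ennreal ?c) \<in> borel_measurable (PiM {1..T} (\<lambda>_. unif))"
      using meas [of t] Suc.prems by (simp add: points_def)
    fix x :: "nat \<Rightarrow> real"
    interpret unif: prob_space unif by (rule prob_space_unif)
    define d where "d = greedy_state N (\<lambda>s. cell N (x s)) t"
    \<comment> \<open>The state after \<open>t\<close> steps ignores coordinate
      \<open>Suc t\<close>, hence it is constant in the integral over \<open>y\<close>.\<close>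
    have d: "greedy_state N (\<lambda>s. cell N ((x(Suc t := y)) s)) t = d" for y
      unfolding d_def by (rule greedy_state_cong) auto
    have "(\<integral>\<^sup>+y. ?P (Suc t) (x(Suc t := y)) \<partial>unif)
        = (\<integral>\<^sup>+y. ennreal (potential N (\<lambda>p. d p + greedy_sign N d (cell N y) * haar p (cell N y))) \<partial>unif)"
      unfolding greedy_state.simps d by simp
    also have "\<dots> = ennreal ((\<Sum>u<2 ^ N. potential N (\<lambda>p. d p + greedy_sign N d u * haar p u)) / 2 ^ N)"
      by (rule nn_integral_cell) (rule potential_nonneg)
    also have "\<dots> \<le> ennreal (potential N d + ?c)"
      using potential_greedy_step [of N d] by (intro ennreal_leI) (simp add: field_simps)
    also have "\<dots> = (\<integral>\<^sup>+y. ?P t (x(Suc t := y)) + ennreal ?c \<partial>unif)"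
      unfolding d by (simp add: unif.emeasure_space_1 potential_nonneg del: space_uniform_measure)
    finally show "(\<integral>\<^sup>+y. ?P (Suc t) (x(Suc t := y)) \<partial>unif) \<le> (\<integral>\<^sup>+y. ?P t (x(Suc t := y)) + ennreal ?c \<partial>unif)" .
  qed simp
  also have "\<dots> = (\<integral>\<^sup>+x. ?P t x \<partial>points T) + ennreal ?c"
    using meas [of t] Suc.prems by (subst nn_integral_add) (auto simp: emeasure_space_1)
  also have "\<dots> \<le> ennreal (?c * (1 + real t)) + ennreal ?c"
    using Suc by (intro add_mono) auto
  also have "\<dots> = ennreal (?c * (1 + real (Suc t)))"
    by (subst ennreal_plus [symmetric]) (auto simp: algebra_simps)
  finally show ?case .
qed

section \<open>Exponential moments of the cell counts\<close>

text \<open>Each factor is 1 or 2, so the product is 2 to the power of the number of points in cell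
  \<open>u\<close>. The logarithm of the sum then bounds all cell counts simultaneously.\<close>

definition occupancy :: "nat \<Rightarrow> (nat \<Rightarrow> nat) \<Rightarrow> nat \<Rightarrow> real" where
  "occupancy N z t = (\<Sum>u<2 ^ N. \<Prod>s=1..t. 1 + of_bool (z s = u))"

lemma occupancy_nonneg: "0 \<le> occupancy N z t"
  unfolding occupancy_def by (intro sum_nonneg prod_nonneg) simp

lemma occupancy_measurable:
  assumes "t \<le> T"
  shows "(\<lambda>x. occupancy N (\<lambda>s. cell N (x s)) t) \<in> borel_measurable (points T)"
  unfolding occupancy_def measurable_points using assms
  by (intro borel_measurable_sum borel_measurable_prod borel_measurable_add measurable_cell_component) auto

text \<open>A new point doubles the term of its own cell and leaves the others alone, so each term
  grows by the factor \<open>1 + 1 / 2 ^ N\<close> in expectation.\<close>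

lemma nn_integral_occupancy_le:
  assumes "t \<le> T"
  shows "(\<integral>\<^sup>+x. ennreal (occupancy N (\<lambda>s. cell N (x s)) t) \<partial>points T)
      \<le> ennreal (2 ^ N * (1 + 1 / 2 ^ N) ^ t)"
  using assms
proof (induction t)
  case 0
  interpret prob_space "points T" by (rule prob_space_points)
  show ?case by (simp add: occupancy_def emeasure_space_1)
next
  case (Suc t)
  let ?P = "\<lambda>t x. ennreal (occupancy N (\<lambda>s. cell N (x s)) t)"
  have meas: "?P t \<in> borel_measurable (points T)" if "t \<le> T" for t
    using occupancy_measurable [OF that] by simp
  have "(\<integral>\<^sup>+x. ?P (Suc t) x \<partial>points T) \<le> (\<integral>\<^sup>+x. ennreal (1 + 1 / 2 ^ N) * ?P t x \<partial>points T)"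
    unfolding points_def
  proof (rule nn_integral_PiM_mono_coordinate [OF prob_space_unif, where i = "Suc t"])
    show "Suc t \<in> {1..T}" using Suc.prems by simp
    show "?P (Suc t) \<in> borel_measurable (PiM {1..T} (\<lambda>_. unif))"
      using meas [of "Suc t"] Suc.prems unfolding points_def by (simp del: greedy_state.simps)
    show "(\<lambda>x. ennreal (1 + 1 / 2 ^ N) * ?P t x) \<in> borel_measurable (PiM {1..T} (\<lambda>_. unif))"
      using meas [of t] Suc.prems by (simp add: points_def)
    fix x :: "nat \<Rightarrow> real"
    interpret unif: prob_space unif by (rule prob_space_unif)
    define z where "z = (\<lambda>s. cell N (x s))"
    define d where "d u = (\<Prod>s=1..t. 1 + of_bool (z s = u) :: real)" for u
    have d0: "0 \<le> d u" for u unfolding d_def by (intro prod_nonneg) simp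
    have prod_eq: "(\<Prod>s=1..t. 1 + of_bool (cell N ((x(Suc t := y)) s) = u)) = d u" for y u
      unfolding d_def z_def by (intro prod.cong) auto
    have "(\<integral>\<^sup>+y. ?P (Suc t) (x(Suc t := y)) \<partial>unif)
        = (\<integral>\<^sup>+y. ennreal (\<Sum>u<2 ^ N. d u * (1 + of_bool (cell N y = u))) \<partial>unif)"
      unfolding occupancy_def using prod_eq by (simp add: prod.nat_ivl_Suc' mult.commute)
    also have "\<dots> = ennreal ((\<Sum>v<2 ^ N. \<Sum>u<2 ^ N. d u * (1 + of_bool (v = u))) / 2 ^ N)"
      using nn_integral_cell [of "\<lambda>v. \<Sum>u<2 ^ N. d u * (1 + of_bool (v = u))" N] d0
      by (simp add: sum_nonneg)
    \<comment> \<open>For fixed \<open>u\<close>, the \<open>2 ^ N\<close> possible cells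
      \<open>v\<close> contribute 1 each, and the choice \<open>v = u\<close> contributes one
      more.\<close>
    also have "(\<Sum>v<2 ^ N. \<Sum>u<2 ^ N. d u * (1 + of_bool (v = u))) = (\<Sum>u<2 ^ N. d u * (2 ^ N + 1))"
      by (subst sum.swap) (auto simp: sum.distrib simp flip: sum_distrib_left intro!: sum.cong)
    also have "(\<Sum>u<2 ^ N. d u * (2 ^ N + 1)) / 2 ^ N = (1 + 1 / 2 ^ N) * (\<Sum>u<2 ^ N. d u)"
      unfolding sum_distrib_right [symmetric] by (simp add: field_simps)
    also have "ennreal \<dots> = (\<integral>\<^sup>+y. ennreal (1 + 1 / 2 ^ N) * ?P t (x(Suc t := y)) \<partial>unif)"
      unfolding occupancy_def prod_eq using d0
      by (simp add: unif.emeasure_space_1 ennreal_mult sum_nonneg del: space_uniform_measure)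
    finally show "(\<integral>\<^sup>+y. ?P (Suc t) (x(Suc t := y)) \<partial>unif)
        \<le> (\<integral>\<^sup>+y. ennreal (1 + 1 / 2 ^ N) * ?P t (x(Suc t := y)) \<partial>unif)" by simp
  qed simp
  also have "\<dots> = ennreal (1 + 1 / 2 ^ N) * (\<integral>\<^sup>+x. ?P t x \<partial>points T)"
    using meas [of t] Suc.prems by (subst nn_integral_cmult) auto
  also have "\<dots> \<le> ennreal (1 + 1 / 2 ^ N) * ennreal (2 ^ N * (1 + 1 / 2 ^ N) ^ t)"
    using Suc by (intro mult_left_mono) auto
  also have "\<dots> = ennreal (2 ^ N * (1 + 1 / 2 ^ N) ^ Suc t)"
    by (subst ennreal_mult [symmetric]) (auto simp: algebra_simps)
  finally show ?case .
qed

lemma cell_count_le_log_occupancy: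
  assumes "t \<le> T" "u < 2 ^ N"
  shows "(\<Sum>s=1..t. of_bool (z s = u)) \<le> log 2 (occupancy N z T)"
proof -
  let ?Q = "\<Prod>s=1..T. 1 + of_bool (z s = u) :: real"
  have "(\<Sum>s=1..t. of_bool (z s = u) :: real) \<le> (\<Sum>s=1..T. of_bool (z s = u))"
    using assms by (intro sum_mono2) auto
  also have "\<dots> = log 2 ?Q"
  proof (induction T)
    case (Suc T)
    have "0 < (\<Prod>s=1..T. 1 + of_bool (z s = u) :: real)"
      by (intro prod_pos) (simp add: add_pos_nonneg)
    then show ?case using Suc by (simp add: log_mult add_pos_nonneg)
  qed simp
  also have "\<dots> \<le> log 2 (occupancy N z T)"
  proof (subst log_le_cancel_iff)
    show "0 < ?Q" by (intro prod_pos) (simp add: add_pos_nonneg)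
    show le: "?Q \<le> occupancy N z T"
      unfolding occupancy_def using assms by (intro member_le_sum prod_nonneg) auto
    show "0 < occupancy N z T" using \<open>0 < ?Q\<close> le by linarith
  qed simp
  finally show ?thesis .
qed

section \<open>The upper bound\<close>

lemma disc_nonneg [simp]: "0 \<le> disc \<sigma> x t I"
  by (simp add: disc_def)

lemma disc_le_sum_abs: "disc \<sigma> x t I \<le> (\<Sum>s=1..t. \<bar>\<sigma> s\<bar>)"
  unfolding disc_def
  by (rule order_trans [OF sum_abs], rule sum_mono) (simp add: abs_mult indicator_def)

lemma empty_in_unit_subintervals: "{} \<in> unit_subintervals"
  by (simp add: unit_subintervals_def is_interval_1)

definition max_disc :: "nat \<Rightarrow> (nat \<Rightarrow> real) \<Rightarrow> (nat \<Rightarrow> real) \<Rightarrow> real" where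
  "max_disc T \<sigma> x = (SUP I\<in>unit_subintervals. MAX t\<in>{1..T}. disc \<sigma> x t I)"

text \<open>A real-valued \<open>SUP\<close> is informative only for a set bounded above; the total
  absolute mass of the signs is such a bound.\<close>

lemma bdd_above_disc:
  assumes "1 \<le> T"
  shows "bdd_above ((\<lambda>I. MAX t\<in>{1..T}. disc \<sigma> x t I) ` unit_subintervals)"
proof (rule bdd_aboveI2)
  fix I :: "real set"
  have "disc \<sigma> x t I \<le> (\<Sum>s=1..T. \<bar>\<sigma> s\<bar>)" if "t \<in> {1..T}" for t
    using that by (intro order_trans [OF disc_le_sum_abs sum_mono2]) auto
  then show "(MAX t\<in>{1..T}. disc \<sigma> x t I) \<le> (\<Sum>s=1..T. \<bar>\<sigma> s\<bar>)"
    using assms by (subst Max_le_iff) auto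
qed

lemma max_disc_le_iff:
  assumes "1 \<le> T"
  shows "max_disc T \<sigma> x \<le> c \<longleftrightarrow> (\<forall>I\<in>unit_subintervals. (MAX t\<in>{1..T}. disc \<sigma> x t I) \<le> c)"
  unfolding max_disc_def using bdd_above_disc [OF assms] empty_in_unit_subintervals
  by (intro cSUP_le_iff) auto

lemma disc_le_max_disc:
  assumes "t \<in> {1..T}" "I \<in> unit_subintervals"
  shows "disc \<sigma> x t I \<le> max_disc T \<sigma> x"
proof -
  have T: "1 \<le> T" using assms by simp
  have "disc \<sigma> x t I \<le> (MAX t\<in>{1..T}. disc \<sigma> x t I)"
    using assms by (intro Max_ge) auto
  also have "\<dots> \<le> max_disc T \<sigma> x"
    unfolding max_disc_def using bdd_above_disc [OF T] assms by (intro cSUP_upper)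
  finally show ?thesis .
qed

lemma max_disc_le:
  assumes "1 \<le> T" "\<And>t I. t \<in> {1..T} \<Longrightarrow> I \<in> unit_subintervals \<Longrightarrow> disc \<sigma> x t I \<le> c"
  shows "max_disc T \<sigma> x \<le> c"
  unfolding max_disc_le_iff [OF assms(1)] using assms by (auto simp: Max_le_iff)

text \<open>The value 0 for pairs that may leave the unit interval cannot exceed
  \<open>max_disc\<close>, which is nonnegative thanks to the empty interval. If
  \<open>x j < x i\<close>, the spanned interval is itself empty.\<close>

definition trace_disc :: "(nat \<Rightarrow> real) \<Rightarrow> (nat \<Rightarrow> real) \<Rightarrow> nat \<times> nat \<times> nat \<Rightarrow> real" where
  "trace_disc \<sigma> x = (\<lambda>(t, i, j). if 0 \<le> x i \<and> x j \<le> 1 then disc \<sigma> x t {x i..x j} else 0)"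

text \<open>The trace of an interval on the points is the trace of an interval spanned by two of them,
  so the supremum over all intervals is a finite maximum and hence measurable.\<close>

lemma max_disc_eq_Max:
  assumes T: "1 \<le> T"
  shows "max_disc T \<sigma> x = Max (trace_disc \<sigma> x ` ({1..T} \<times> {1..T} \<times> {1..T}))" (is "_ = Max (_ ` ?S)")
proof (rule antisym)
  have S: "finite ?S" "?S \<noteq> {}" using T by auto
  have le: "trace_disc \<sigma> x q \<le> Max (trace_disc \<sigma> x ` ?S)" if "q \<in> ?S" for q
    using S that by (intro Max_ge) auto
  show "max_disc T \<sigma> x \<le> Max (trace_disc \<sigma> x ` ?S)"
  proof (rule max_disc_le [OF T])
    fix t I assume t: "t \<in> {1..T}" and I: "I \<in> unit_subintervals"
    show "disc \<sigma> x t I \<le> Max (trace_disc \<sigma> x ` ?S)"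
    proof (cases "\<exists>s\<in>{1..T}. x s \<in> I")
      case False
      then have "disc \<sigma> x t I = 0" using t by (auto simp: disc_def intro!: sum.neutral)
      also have "0 \<le> trace_disc \<sigma> x (1, 1, 1)" by (simp add: trace_disc_def)
      also have "\<dots> \<le> Max (trace_disc \<sigma> x ` ?S)" using T by (intro le) auto
      finally show ?thesis .
    next
      case True
      have "is_interval I" "I \<subseteq> {0..1}" using I by (auto simp: unit_subintervals_def)
      then obtain i j where ij: "i \<in> {1..T}" "j \<in> {1..T}" "x i \<in> I" "x j \<in> I"
        and tr: "\<And>s. s \<in> {1..T} \<Longrightarrow> x s \<in> I \<longleftrightarrow> x i \<le> x s \<and> x s \<le> x j"
        using interval_trace [OF _ _ True] by auto
      have "disc \<sigma> x t I = disc \<sigma> x t {x i..x j}"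
        unfolding disc_def using t tr by (auto simp: indicator_def intro!: arg_cong [where f = abs] sum.cong)
      also have "\<dots> = trace_disc \<sigma> x (t, i, j)"
        using ij \<open>I \<subseteq> {0..1}\<close> by (auto simp: trace_disc_def)
      also have "\<dots> \<le> Max (trace_disc \<sigma> x ` ?S)" using t ij by (intro le) auto
      finally show ?thesis .
    qed
  qed
  show "Max (trace_disc \<sigma> x ` ?S) \<le> max_disc T \<sigma> x"
  proof (subst Max_le_iff)
    show "\<forall>a\<in>trace_disc \<sigma> x ` ?S. a \<le> max_disc T \<sigma> x"
    proof clarify
      fix t i j assume t: "t \<in> {1..T}"
      show "trace_disc \<sigma> x (t, i, j) \<le> max_disc T \<sigma> x"
      proof (cases "0 \<le> x i \<and> x j \<le> 1")
        case True
        then have "{x i..x j} \<in> unit_subintervals"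
          by (auto simp: unit_subintervals_def is_interval_1)
        then show ?thesis using True disc_le_max_disc [OF t] by (simp add: trace_disc_def)
      next
        case False
        have "0 \<le> disc \<sigma> x t {}" by simp
        also have "\<dots> \<le> max_disc T \<sigma> x" by (intro disc_le_max_disc t empty_in_unit_subintervals)
        finally show ?thesis unfolding trace_disc_def prod.case if_not_P [OF False] .
      qed
    qed
  qed (use S in auto)
qed

text \<open>Stated over an arbitrary space, so that it serves both \<open>points T\<close> and the
  product with a seed space. Intervals with random endpoints become comparisons of
  coordinates.\<close>

lemma max_disc_measurable:
  assumes T: "1 \<le> T"
    and \<sigma>: "\<And>t. t \<in> {1..T} \<Longrightarrow> (\<lambda>\<omega>. \<sigma> \<omega> t) \<in> borel_measurable M"
    and x: "\<And>t. t \<in> {1..T} \<Longrightarrow> (\<lambda>\<omega>. x \<omega> t) \<in> borel_measurable M"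
  shows "(\<lambda>\<omega>. max_disc T (\<sigma> \<omega>) (x \<omega>)) \<in> borel_measurable M"
  unfolding max_disc_eq_Max [OF T]
proof (rule borel_measurable_Max)
  fix q assume "q \<in> {1..T} \<times> {1..T} \<times> {1..T}"
  then obtain t i j where q: "q = (t, i, j)" "t \<in> {1..T}" "i \<in> {1..T}" "j \<in> {1..T}" by auto
  have [measurable]: "(\<lambda>\<omega>. x \<omega> i) \<in> borel_measurable M" "(\<lambda>\<omega>. x \<omega> j) \<in> borel_measurable M"
    using q x by auto
  have "(\<lambda>\<omega>. \<sigma> \<omega> s * (if x \<omega> i \<le> x \<omega> s \<and> x \<omega> s \<le> x \<omega> j then 1 else 0)) \<in> borel_measurable M"
    if "s \<in> {1..t}" for s
  proof -
    have [measurable]: "(\<lambda>\<omega>. x \<omega> s) \<in> borel_measurable M" "(\<lambda>\<omega>. \<sigma> \<omega> s) \<in> borel_measurable M"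
      using that q x \<sigma> by auto
    show ?thesis by measurable
  qed
  then have [measurable]: "(\<lambda>\<omega>. \<Sum>s=1..t. \<sigma> \<omega> s * (if x \<omega> i \<le> x \<omega> s \<and> x \<omega> s \<le> x \<omega> j then 1 else 0))
      \<in> borel_measurable M"
    by (rule borel_measurable_sum)
  show "(\<lambda>\<omega>. trace_disc (\<sigma> \<omega>) (x \<omega>) q) \<in> borel_measurable M"
    unfolding trace_disc_def disc_def q(1) indicator_def atLeastAtMost_iff prod.case of_bool_def by measurable
qed simp

section \<open>Choice of the depth and Markov's inequality\<close>

lemma card_haar_index_le: "card (haar_index N) \<le> (N + 1) * 2 ^ N"
proof -
  have "card (haar_index N) = (\<Sum>l\<le>N. 2 ^ (N - 1 - l))"
    by (simp add: haar_index_def)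
  also have "\<dots> \<le> (\<Sum>l\<le>N. 2 ^ N)"
    by (intro sum_mono power_increasing) auto
  finally show ?thesis by simp
qed

definition depth :: "nat \<Rightarrow> nat" where
  "depth T = nat \<lceil>log 2 (real T)\<rceil>"

lemma depth_bounds:
  assumes "2 \<le> T"
  shows "real T \<le> 2 ^ depth T" "2 ^ depth T \<le> 2 * real T" "real (depth T) + 1 \<le> 3 * log 2 (real T)"
    "1 \<le> log 2 (real T)"
proof -
  have "log 2 2 \<le> log 2 (real T)" using assms by (intro log_mono) auto
  then show L: "1 \<le> log 2 (real T)" by simp
  then have d: "real (depth T) = of_int \<lceil>log 2 (real T)\<rceil>" by (simp add: depth_def)
  have lo: "log 2 (real T) \<le> real (depth T)" and up: "real (depth T) \<le> log 2 (real T) + 1"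
    unfolding d by linarith+
  \<comment> \<open>The left side is at most \<open>log 2 (real T) + 2\<close>, and the logarithm is
    at least 1.\<close>
  show "real (depth T) + 1 \<le> 3 * log 2 (real T)" using up L by simp
  have T: "2 powr log 2 (real T) = real T" using assms by simp
  have "2 powr log 2 (real T) \<le> 2 powr real (depth T)" using lo by simp
  then show "real T \<le> 2 ^ depth T" unfolding T by (simp add: powr_realpow)
  have "2 powr real (depth T) \<le> 2 powr (log 2 (real T) + 1)" using up by simp
  then show "2 ^ depth T \<le> 2 * real T" unfolding powr_add T by (simp add: powr_realpow)
qed

text \<open>The factor 2 in \<open>exp \<bar>y\<bar> \<le> 2 * cosh y\<close> is absorbed into
  \<open>r\<close>, later taken to be \<open>T\<close>, so that only powers of \<open>T\<close>
  appear under the logarithm.\<close>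

lemma abs_le_of_cosh_le:
  fixes y :: real
  assumes "cosh y \<le> K" "2 \<le> r" "0 < K"
  shows "\<bar>y\<bar> \<le> ln (r * K)"
proof -
  have "exp \<bar>y\<bar> \<le> 2 * cosh y" by (simp add: cosh_def abs_if)
  also have "\<dots> \<le> r * K" using assms by (intro mult_mono) (auto simp: cosh_real_nonneg)
  finally have "ln (exp \<bar>y\<bar>) \<le> ln (r * K)" by (intro ln_mono) auto
  then show ?thesis by simp
qed

text \<open>Adding the potentials of all times lets one use of Markov's inequality control every
  time at once. The price is a further factor \<open>T\<close>, harmless inside a logarithm.\<close>

definition total_potential :: "nat \<Rightarrow> nat \<Rightarrow> (nat \<Rightarrow> real) \<Rightarrow> real" where
  "total_potential N T x = (\<Sum>t=1..T. potential N (greedy_state N (\<lambda>s. cell N (x s)) t))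
     + occupancy N (\<lambda>s. cell N (x s)) T"

text \<open>The three logarithms are the inverse rate, the logarithm of the potential, and the
  number of blocks in a dyadic prefix.\<close>

lemma max_disc_greedy_le:
  assumes T: "2 \<le> T" and W: "total_potential (depth T) T x \<le> real T ^ m"
  shows "max_disc T (signing (greedy_algorithm (depth T)) x) x \<le> 20 * (real m + 1) * log 2 (real T) ^ 3"
proof (rule max_disc_le)
  show "1 \<le> T" using T by simp
  fix t I assume t: "t \<in> {1..T}" and I: "I \<in> unit_subintervals"
  define N where "N = depth T"
  define L where "L = log 2 (real T)"
  define z where "z = (\<lambda>s. cell N (x s))"
  define \<sigma> where "\<sigma> = signing (greedy_algorithm N) x"
  have L: "1 \<le> L" and N: "real N + 1 \<le> 3 * L"
    using depth_bounds [OF T] by (auto simp: L_def N_def)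
  have ln: "ln (real T) \<le> L"
  proof -
    have "ln (real T) * ln 2 \<le> ln (real T) * 1"
      using T by (intro mult_left_mono) (auto simp: ln_le_minus_one[THEN order_trans])
    then show ?thesis by (simp add: L_def log_def field_simps)
  qed
  have \<sigma>: "\<sigma> s = greedy N z s" if "1 \<le> s" for s
    using signing_greedy_algorithm [OF that] by (simp add: \<sigma>_def z_def)
  have pot: "potential N (greedy_state N z t) \<le> real T ^ m"
  proof -
    have "potential N (greedy_state N z t) \<le> (\<Sum>t=1..T. potential N (greedy_state N z t))"
      using t by (intro member_le_sum) (auto simp: potential_nonneg)
    then show ?thesis using W occupancy_nonneg [of N z T]
      by (simp add: total_potential_def N_def z_def)
  qed
  have occ: "occupancy N z T \<le> real T ^ m"
    using W sum_nonneg [of "{1..T}" "\<lambda>t. potential N (greedy_state N z t)"]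
    by (simp add: total_potential_def N_def z_def potential_nonneg)
  \<comment> \<open>From \<open>cosh (rate N * d) \<le> T ^ m\<close> the scaled sum is at most
    \<open>ln (T * T ^ m)\<close>; dividing by the rate gives \<open>?B\<close>.\<close>
  let ?B = "(real N + 1) * ((real m + 1) * L)"
  have "disc \<sigma> x t I = disc (greedy N z) x t I"
    unfolding disc_def using \<sigma> by (auto intro!: arg_cong [where f = abs] sum.cong)
  also have "\<dots> \<le> 2 * (real N + 1) * ?B + 2 * (real m * L)"
  proof (rule disc_interval_le)
    show "\<bar>greedy N z s\<bar> \<le> 1" for s using greedy_cases [of N z s] by auto
    show "is_interval I" using I by (simp add: unit_subintervals_def)
    show "\<bar>\<Sum>s=1..t. greedy N z s * haar p (cell N (x s))\<bar> \<le> ?B" if p: "p \<in> haar_index N" for p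
    proof -
      let ?d = "greedy_state N z t p"
      have "cosh (rate N * ?d) \<le> potential N (greedy_state N z t)"
        unfolding potential_def using p by (intro member_le_sum) auto
      then have "\<bar>rate N * ?d\<bar> \<le> ln (real T * real T ^ m)"
        using pot T by (intro abs_le_of_cosh_le) auto
      also have "\<dots> = (real m + 1) * ln (real T)"
        using T by (simp add: ln_mult ln_realpow algebra_simps)
      also have "\<dots> \<le> (real m + 1) * L" by (intro mult_left_mono ln) auto
      finally have "\<bar>?d\<bar> \<le> ?B"
        by (simp add: rate_def abs_mult field_simps)
      then show ?thesis by (simp add: greedy_state_eq_sum z_def)
    qed
    show "(\<Sum>s=1..t. of_bool (cell N (x s) = u)) \<le> real m * L" if u: "u < 2 ^ N" for u
    proof -
      have pos: "0 < occupancy N z T"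
        unfolding occupancy_def by (intro sum_pos prod_pos) (auto simp: add_pos_nonneg lessThan_empty_iff)
      have "(\<Sum>s=1..t. of_bool (z s = u)) \<le> log 2 (occupancy N z T)"
        using t u by (intro cell_count_le_log_occupancy) auto
      also have "\<dots> \<le> log 2 (real T ^ m)" using occ pos by (intro log_mono) auto
      also have "\<dots> = real m * L" using T by (simp add: L_def log_nat_power)
      finally show ?thesis by (simp add: z_def)
    qed
  qed
  \<comment> \<open>The Haar part contributes \<open>2 * 3 * 3 = 18\<close> by
    \<open>N + 1 \<le> 3 * L\<close>, the two boundary cells contribute 2.\<close>
  also have "\<dots> \<le> 20 * (real m + 1) * L ^ 3"
  proof -
    have "(real N + 1) * (real N + 1) \<le> (3 * L) * (3 * L)"
      using N by (intro mult_mono) auto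
    then have "2 * ((real m + 1) * L) * ((real N + 1) * (real N + 1)) \<le> 2 * ((real m + 1) * L) * ((3 * L) * (3 * L))"
      using L by (intro mult_left_mono) auto
    moreover have "real m * L \<le> (real m + 1) * L ^ 3"
      using L self_le_power [of L 3] by (intro mult_mono) auto
    ultimately show ?thesis by (simp add: algebra_simps power3_eq_cube)
  qed
  finally show "disc (signing (greedy_algorithm (depth T)) x) x t I
      \<le> 20 * (real m + 1) * log 2 (real T) ^ 3"
    by (simp add: \<sigma>_def N_def L_def)
qed

lemma total_potential_measurable: "total_potential N T \<in> borel_measurable (points T)"
  unfolding total_potential_def
  by (intro borel_measurable_add borel_measurable_sum potential_measurable occupancy_measurable) auto

text \<open>The index set has at most \<open>4 * T ^ 2\<close> elements, so the \<open>T\<close>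
  potentials contribute at most \<open>8 * T ^ 4\<close>. The occupancy contributes at most
  \<open>6 * T ^ 4\<close>, because its growth factor is at most \<open>exp 1\<close>. Finally
  \<open>14 \<le> 2 ^ 4 \<le> T ^ 4\<close>.\<close>

lemma nn_integral_total_potential_le:
  assumes T: "2 \<le> T"
  shows "(\<integral>\<^sup>+x. ennreal (total_potential (depth T) T x) \<partial>points T) \<le> ennreal (real T ^ 8)"
proof -
  define N where "N = depth T"
  let ?c = "real (card (haar_index N))"
  have N: "real T \<le> 2 ^ N" "2 ^ N \<le> 2 * real T" using depth_bounds [OF T] by (auto simp: N_def)
  have T2: "2 \<le> real T" using T by simp
  let ?P = "\<lambda>t x. potential N (greedy_state N (\<lambda>s. cell N (x s)) t)"
  let ?O = "\<lambda>x. occupancy N (\<lambda>s. cell N (x s)) T"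
  have mP: "?P t \<in> borel_measurable (points T)" if "t \<in> {1..T}" for t
    using that by (intro potential_measurable) auto
  have mO: "?O \<in> borel_measurable (points T)"
    by (rule occupancy_measurable) simp
  have sum_eq: "(\<integral>\<^sup>+x. (\<Sum>t=1..T. ennreal (?P t x)) \<partial>points T) = (\<Sum>t=1..T. \<integral>\<^sup>+x. ennreal (?P t x) \<partial>points T)"
    by (rule nn_integral_sum) (use mP in auto)
  have "(\<integral>\<^sup>+x. ennreal (total_potential N T x) \<partial>points T)
      = (\<integral>\<^sup>+x. (\<Sum>t=1..T. ennreal (?P t x)) + ennreal (?O x) \<partial>points T)"
    by (simp add: total_potential_def potential_nonneg occupancy_nonneg sum_nonneg)
  also have "\<dots> = (\<Sum>t=1..T. \<integral>\<^sup>+x. ennreal (?P t x) \<partial>points T) + (\<integral>\<^sup>+x. ennreal (?O x) \<partial>points T)"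
    unfolding sum_eq [symmetric] using mP mO by (intro nn_integral_add borel_measurable_sum) auto
  also have "\<dots> \<le> (\<Sum>t=1..T. ennreal (?c * (1 + real T))) + ennreal (2 ^ N * (1 + 1 / 2 ^ N) ^ T)"
  proof (intro add_mono sum_mono nn_integral_occupancy_le order_refl)
    fix t assume t: "t \<in> {1..T}"
    have "(\<integral>\<^sup>+x. ennreal (?P t x) \<partial>points T) \<le> ennreal (?c * (1 + real t))"
      using t by (intro nn_integral_potential_le) auto
    also have "\<dots> \<le> ennreal (?c * (1 + real T))"
      using t by (intro ennreal_leI mult_left_mono) auto
    finally show "(\<integral>\<^sup>+x. ennreal (?P t x) \<partial>points T) \<le> ennreal (?c * (1 + real T))" .
  qed
  also have "\<dots> = ennreal (real T * (?c * (1 + real T)) + 2 ^ N * (1 + 1 / 2 ^ N) ^ T)"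
    by (simp add: ennreal_mult ennreal_of_nat_eq_real_of_nat)
  also have "\<dots> \<le> ennreal (real T ^ 8)"
  proof (rule ennreal_leI)
    have "N + 1 \<le> 2 ^ N" by (simp add: Suc_leI)
    then have "(N + 1) * 2 ^ N \<le> 2 ^ N * 2 ^ N" by (rule mult_right_mono) simp
    then have "card (haar_index N) \<le> 2 ^ N * 2 ^ N" using card_haar_index_le [of N] by linarith
    then have "?c \<le> real (2 ^ N * 2 ^ N)" by (simp only: of_nat_le_iff)
    also have "\<dots> = 2 ^ N * 2 ^ N" by simp
    also have "\<dots> \<le> (2 * real T) * (2 * real T)" using N by (intro mult_mono) auto
    finally have c: "?c \<le> 4 * real T ^ 2" by (simp add: power2_eq_square)
    have "?c * (1 + real T) \<le> (4 * real T ^ 2) * (2 * real T)"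
      using c T2 by (intro mult_mono) auto
    then have "real T * (?c * (1 + real T)) \<le> real T * ((4 * real T ^ 2) * (2 * real T))"
      by (intro mult_left_mono) auto
    also have "\<dots> = 8 * real T ^ 4" by (simp add: power2_eq_square power4_eq_xxxx)
    finally have 1: "real T * (?c * (1 + real T)) \<le> 8 * real T ^ 4" .
    have "(1 + 1 / 2 ^ N) ^ T \<le> exp (1 / 2 ^ N :: real) ^ T"
      using exp_ge_add_one_self [of "1 / 2 ^ N"] by (intro power_mono) auto
    also have "\<dots> = exp (real T * (1 / 2 ^ N))" by (rule exp_of_nat_mult [symmetric])
    also have "\<dots> \<le> exp 1" using N by simp
    also have "\<dots> \<le> 3" by (rule exp_le)
    finally have "2 ^ N * (1 + 1 / 2 ^ N) ^ T \<le> (2 * real T) * 3"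
      using N by (intro mult_mono) auto
    also have "\<dots> \<le> 6 * real T ^ 4"
      using T2 self_le_power [of "real T" 4] by simp
    finally have 2: "2 ^ N * (1 + 1 / 2 ^ N) ^ T \<le> 6 * real T ^ 4" .
    have "2 ^ 4 \<le> real T ^ 4" using T2 by (intro power_mono) auto
    then have "14 * real T ^ 4 \<le> real T ^ 4 * real T ^ 4" by (intro mult_right_mono) auto
    then show "real T * (?c * (1 + real T)) + 2 ^ N * (1 + 1 / 2 ^ N) ^ T \<le> real T ^ 8"
      using 1 2 by (simp flip: power_add)
  qed
  finally show ?thesis by (simp add: N_def)
qed

lemma greedy_algorithm_high_probability:
  assumes T: "2 \<le> T"
  shows "measure (points T) {x \<in> space (points T).
      max_disc T (signing (greedy_algorithm (depth T)) x) x \<le> 20 * (real k + 9) * log 2 (real T) ^ 3}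
    \<ge> 1 - 1 / real T ^ k" (is "measure _ ?E \<ge> _")
proof -
  interpret prob_space "points T" by (rule prob_space_points)
  \<comment> \<open>The mean of the total potential is at most \<open>T ^ 8\<close>, so exceeding
    this threshold has probability at most \<open>1 / T ^ k\<close>. With \<open>m = k + 8\<close>
    the constant \<open>m + 1\<close> becomes \<open>k + 9\<close>.\<close>
  let ?K = "real T ^ (k + 8)"
  let ?W = "total_potential (depth T) T"
  have [measurable]: "?W \<in> borel_measurable (points T)" by (rule total_potential_measurable)
  have W0: "0 \<le> ?W x" for x
    unfolding total_potential_def by (intro add_nonneg_nonneg sum_nonneg potential_nonneg occupancy_nonneg)
  have K: "0 < ?K" using T by simp
  define bad where "bad = {x \<in> space (points T). ?K \<le> ?W x}"
  have bad: "bad \<in> events" unfolding bad_def by measurable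
  have "emeasure (points T) bad
      = emeasure (points T) {x \<in> space (points T). 1 \<le> ennreal (1 / ?K) * ennreal (?W x)}"
  proof (intro arg_cong [where f = "emeasure (points T)"], unfold bad_def, intro Collect_cong conj_cong refl)
    fix x
    have "1 \<le> ennreal (1 / ?K) * ennreal (?W x) \<longleftrightarrow> ennreal 1 \<le> ennreal (1 / ?K * ?W x)"
      using W0 K by (subst ennreal_mult) auto
    also have "\<dots> \<longleftrightarrow> 1 \<le> 1 / ?K * ?W x"
      using W0 [of x] K by (intro ennreal_le_iff) (auto intro: divide_nonneg_pos)
    also have "\<dots> \<longleftrightarrow> ?K \<le> ?W x" using K by (simp add: field_simps)
    finally show "?K \<le> ?W x \<longleftrightarrow> 1 \<le> ennreal (1 / ?K) * ennreal (?W x)" by simp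
  qed
  also have "\<dots> \<le> ennreal (1 / ?K) * (\<integral>\<^sup>+x. ennreal (?W x) * indicator (space (points T)) x \<partial>points T)"
    by (rule nn_integral_Markov_inequality) auto
  also have "(\<integral>\<^sup>+x. ennreal (?W x) * indicator (space (points T)) x \<partial>points T)
      = (\<integral>\<^sup>+x. ennreal (?W x) \<partial>points T)"
    by (intro nn_integral_cong) simp
  also have "ennreal (1 / ?K) * (\<integral>\<^sup>+x. ennreal (?W x) \<partial>points T) \<le> ennreal (1 / ?K) * ennreal (real T ^ 8)"
    by (intro mult_left_mono nn_integral_total_potential_le T) auto
  also have "\<dots> = ennreal (1 / real T ^ k)"
    using T by (subst ennreal_mult [symmetric]) (auto simp: power_add)
  finally have "emeasure (points T) bad \<le> ennreal (1 / real T ^ k)" .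
  then have "prob bad \<le> 1 / real T ^ k" by (simp add: emeasure_eq_measure)
  then have "1 - 1 / real T ^ k \<le> prob (space (points T) - bad)"
    using prob_compl [OF bad] by simp
  also have "\<dots> \<le> prob ?E"
  proof (rule finite_measure_mono)
    show "space (points T) - bad \<subseteq> ?E"
      using max_disc_greedy_le [OF T, of _ "k + 8"] by (auto simp: bad_def algebra_simps)
    have "(\<lambda>x. max_disc T (signing (greedy_algorithm (depth T)) x) x) \<in> borel_measurable (points T)"
    proof (rule max_disc_measurable)
      show "1 \<le> T" using T by simp
      fix t assume t: "t \<in> {1..T}"
      show "(\<lambda>x. signing (greedy_algorithm (depth T)) x t) \<in> borel_measurable (points T)"
        using t unfolding measurable_points
        by (subst signing_greedy_algorithm) (auto intro!: greedy_measurable)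
      show "(\<lambda>x. x t) \<in> borel_measurable (points T)"
        unfolding measurable_points by (rule measurable_component_singleton [OF t])
    qed
    then show "?E \<in> events" by measurable
  qed
  finally show ?thesis .
qed

section \<open>Tents and orthogonal rectangles\<close>

lemma nat_div_eq_iff:
  fixes u k v :: nat
  assumes "0 < k"
  shows "u div k = v \<longleftrightarrow> v * k \<le> u \<and> u < v * k + k"
proof
  assume "u div k = v"
  then have "v * k + u mod k = u" using div_mult_mod_eq [of u k] by simp
  then show "v * k \<le> u \<and> u < v * k + k"
    using mod_less_divisor [OF assms, of u] by (intro conjI; linarith)
next
  assume "v * k \<le> u \<and> u < v * k + k"
  then show "u div k = v" by (intro div_nat_eqI) (auto simp: mult.commute)
qed

text \<open>Prefix sums of a Haar function trace a discrete tent over its block, of height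
  \<open>2 ^ l\<close> at the midpoint (a Schauder function).\<close>

definition tent :: "nat \<times> nat \<Rightarrow> nat \<Rightarrow> real" where
  "tent p u = (\<Sum>m<u. haar p m)"

lemma haar_eq_step:
  "haar (l, i) u = (if 2 ^ Suc l * i \<le> u \<and> u < 2 ^ Suc l * i + 2 ^ l then 1
     else if 2 ^ Suc l * i + 2 ^ l \<le> u \<and> u < 2 ^ Suc l * i + 2 * 2 ^ l then - 1 else 0)"
proof -
  have "haar (l, i) u = (if u div 2 ^ l = 2 * i then 1 else if u div 2 ^ l = 2 * i + 1 then - 1 else 0)"
    unfolding haar_def div_pow_Suc fst_conv snd_conv by auto
  moreover have "u div 2 ^ l = 2 * i \<longleftrightarrow> 2 ^ Suc l * i \<le> u \<and> u < 2 ^ Suc l * i + 2 ^ l"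
    by (subst nat_div_eq_iff) (auto simp: mult_ac)
  moreover have "u div 2 ^ l = 2 * i + 1 \<longleftrightarrow> 2 ^ Suc l * i + 2 ^ l \<le> u \<and> u < 2 ^ Suc l * i + 2 * 2 ^ l"
    by (subst nat_div_eq_iff) (auto simp: algebra_simps)
  ultimately show ?thesis by simp
qed

lemma sum_step_function:
  fixes A k u :: nat
  shows "(\<Sum>m<u. if A \<le> m \<and> m < A + k then 1 else if A + k \<le> m \<and> m < A + 2 * k then - 1 else 0)
     = max 0 (min (real u - real A) (real A + 2 * real k - real u))"
proof (induction u)
  case (Suc u)
  consider "Suc u \<le> A" | "A \<le> u" "Suc u \<le> A + k" | "A + k \<le> u" "Suc u \<le> A + 2 * k" | "A + 2 * k \<le> u"
    by linarith
  then show ?case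
  proof cases
    case 1
    then have "real u + 1 \<le> real A" by linarith
    then show ?thesis using Suc 1 by (simp add: max_def min_def)
  next
    case 2
    then have "real A \<le> real u" "real u + 1 \<le> real A + real k" by linarith+
    then show ?thesis using Suc 2 by (simp add: max_def min_def)
  next
    case 3
    then have "real A + real k \<le> real u" "real u + 1 \<le> real A + 2 * real k" by linarith+
    then show ?thesis using Suc 3 by (simp add: max_def min_def)
  next
    case 4
    then have "real A + 2 * real k \<le> real u" by linarith
    then show ?thesis using Suc 4 by (simp add: max_def min_def)
  qed
qed (simp add: max_def min_def)

lemma tent_eq:
  "tent (l, i) u = max 0 (min (real u - 2 ^ Suc l * real i) (2 ^ Suc l * real i + 2 ^ Suc l - real u))"
  unfolding tent_def haar_eq_step sum_step_function by simp

lemma tent_nonneg: "0 \<le> tent p u"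
  by (cases p) (simp add: tent_eq)

lemma tent_le: "tent (l, i) u \<le> 2 ^ l * of_bool (u div 2 ^ Suc l = i)"
proof -
  have "u div 2 ^ Suc l = i \<longleftrightarrow> i * 2 ^ Suc l \<le> u \<and> u < i * 2 ^ Suc l + 2 ^ Suc l"
    by (rule nat_div_eq_iff) simp
  also have "\<dots> \<longleftrightarrow> real (i * 2 ^ Suc l) \<le> real u \<and> real u < real (i * 2 ^ Suc l + 2 ^ Suc l)"
    by (simp only: of_nat_le_iff of_nat_less_iff)
  finally have *: "u div 2 ^ Suc l = i \<longleftrightarrow> 2 ^ Suc l * real i \<le> real u \<and> real u < 2 ^ Suc l * real i + 2 ^ Suc l"
    by (simp add: mult_ac)
  define y where "y = 2 ^ Suc l * real i"
  show ?thesis unfolding * tent_eq y_def [symmetric] by (auto simp: max_def min_def)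
qed

text \<open>With half-length \<open>k = 2 ^ l\<close>, the value \<open>r\<close> on the rising half
  is paired with \<open>k - r\<close> on the falling half. The \<open>k\<close> pairs give
  \<open>k * k\<close>.\<close>

lemma sum_tent_ge:
  assumes "l < N" "i < 2 ^ (N - 1 - l)"
  shows "2 ^ l * 2 ^ l \<le> (\<Sum>u<2 ^ N. tent (l, i) u)"
proof -
  define k where "k = (2::nat) ^ l"
  define A where "A = 2 * k * i"
  have rk: "real k = 2 ^ l" by (simp add: k_def)
  have N: "2 ^ N = 2 ^ (N - 1 - l) * (2 * k)"
    using assms by (simp add: k_def flip: power_Suc power_add)
  have "(i + 1) * (2 * k) \<le> 2 ^ (N - 1 - l) * (2 * k)"
    using assms by (intro mult_right_mono) auto
  then have A: "A + 2 * k \<le> 2 ^ N" unfolding N A_def by (simp add: algebra_simps)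
  have t: "tent (l, i) (r + A) = min (real r) (2 * real k - real r)" if "r < 2 * k" for r
  proof -
    have "real r < 2 * real k" using that by linarith
    then show ?thesis by (simp add: tent_eq A_def rk)
  qed
  have "2 ^ l * 2 ^ l = (\<Sum>r<k. real r + (real k - real r))"
    by (simp add: rk)
  also have "\<dots> = (\<Sum>r<k. tent (l, i) (r + A)) + (\<Sum>r<k. tent (l, i) (r + k + A))"
    unfolding sum.distrib by (intro arg_cong2 [where f = "(+)"] sum.cong refl, simp_all add: t)
  also have "(\<Sum>r<k. tent (l, i) (r + k + A)) = (\<Sum>r=k..<2 * k. tent (l, i) (r + A))"
    using sum.shift_bounds_nat_ivl [of "\<lambda>r. tent (l, i) (r + A)" 0 k k]
    by (simp add: lessThan_atLeast0 mult_2)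
  also have "(\<Sum>r<k. tent (l, i) (r + A)) + \<dots> = (\<Sum>r<2 * k. tent (l, i) (r + A))"
    unfolding lessThan_atLeast0 by (rule sum.atLeastLessThan_concat) auto
  also have "\<dots> = (\<Sum>u=A..<2 * k + A. tent (l, i) u)"
    using sum.shift_bounds_nat_ivl [of "tent (l, i)" 0 A "2 * k"] by (simp add: lessThan_atLeast0)
  also have "\<dots> \<le> (\<Sum>u<2 ^ N. tent (l, i) u)"
    using A by (intro sum_mono2) (auto simp: tent_nonneg)
  finally show ?thesis .
qed

text \<open>The Haar function has mean zero, so its sum from \<open>u\<close> on is minus its prefix
  sum before \<open>u\<close>.\<close>

lemma sum_haar_mult_ge:
  assumes "fst p < N" "u < 2 ^ N"
  shows "(\<Sum>m<2 ^ N. haar p m * of_bool (u \<le> m)) = - tent p u"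
proof -
  obtain l i where p: "p = (l, i)" by force
  have "(\<Sum>m<2 ^ N. haar p m * of_bool (u \<le> m)) + (\<Sum>m<2 ^ N. haar p m * of_bool (m < u))
      = (\<Sum>m<2 ^ N. haar p m)"
    unfolding sum.distrib [symmetric] by (intro sum.cong) auto
  also have "\<dots> = 0" using sum_haar_mult_coarser [of l N i "\<lambda>_. 1"] assms p by simp
  also have "(\<Sum>m<2 ^ N. haar p m * of_bool (m < u)) = tent p u"
    unfolding tent_def using assms by (intro sum.mono_neutral_cong_right) auto
  finally show ?thesis by linarith
qed

text \<open>Duality: the sign combination of the \<open>\<phi> r\<close> has small L1 norm by Cauchy-Schwarz.\<close>

lemma sum_abs_inner_le:
  fixes \<phi> :: "'r \<Rightarrow> 'w \<Rightarrow> real"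
  assumes fin: "finite R" "finite \<Omega>"
    and orth: "\<And>r r'. r \<in> R \<Longrightarrow> r' \<in> R \<Longrightarrow> r \<noteq> r' \<Longrightarrow> (\<Sum>w\<in>\<Omega>. \<phi> r w * \<phi> r' w) = 0"
    and norm: "\<And>r. r \<in> R \<Longrightarrow> (\<Sum>w\<in>\<Omega>. \<phi> r w * \<phi> r w) \<le> \<nu>"
    and D: "\<And>w. w \<in> \<Omega> \<Longrightarrow> \<bar>D w\<bar> \<le> S" and S: "0 \<le> S"
  shows "(\<Sum>r\<in>R. \<bar>\<Sum>w\<in>\<Omega>. D w * \<phi> r w\<bar>) \<le> S * sqrt (real (card \<Omega>) * (real (card R) * \<nu>))"
proof -
  define e where "e r = sgn (\<Sum>w\<in>\<Omega>. D w * \<phi> r w)" for r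
  define F where "F w = (\<Sum>r\<in>R. e r * \<phi> r w)" for w
  have e: "e r * e r * x \<le> x" if "0 \<le> x" for r x using that by (auto simp: e_def sgn_if)
  have "(\<Sum>w\<in>\<Omega>. F w * F w) = (\<Sum>w\<in>\<Omega>. \<Sum>r\<in>R. \<Sum>r'\<in>R. e r * e r' * (\<phi> r w * \<phi> r' w))"
    unfolding F_def sum_product by (simp add: mult_ac)
  also have "\<dots> = (\<Sum>r\<in>R. \<Sum>w\<in>\<Omega>. \<Sum>r'\<in>R. e r * e r' * (\<phi> r w * \<phi> r' w))"
    by (rule sum.swap)
  also have "\<dots> = (\<Sum>r\<in>R. \<Sum>r'\<in>R. \<Sum>w\<in>\<Omega>. e r * e r' * (\<phi> r w * \<phi> r' w))"
    by (intro sum.cong refl sum.swap)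
  also have "\<dots> = (\<Sum>r\<in>R. \<Sum>r'\<in>R. e r * e r' * (\<Sum>w\<in>\<Omega>. \<phi> r w * \<phi> r' w))"
    by (simp add: sum_distrib_left)
  also have "\<dots> = (\<Sum>r\<in>R. \<Sum>r'\<in>R. if r' = r then e r * e r * (\<Sum>w\<in>\<Omega>. \<phi> r w * \<phi> r w) else 0)"
    using orth by (intro sum.cong refl) auto
  also have "\<dots> = (\<Sum>r\<in>R. e r * e r * (\<Sum>w\<in>\<Omega>. \<phi> r w * \<phi> r w))"
    using fin by simp
  also have "\<dots> \<le> (\<Sum>r\<in>R. \<nu>)"
    by (intro sum_mono order_trans [OF e norm] sum_nonneg) auto
  finally have F: "(\<Sum>w\<in>\<Omega>. F w * F w) \<le> real (card R) * \<nu>" by simp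
  have "(\<Sum>w\<in>\<Omega>. 1 * \<bar>F w\<bar>)\<^sup>2 \<le> (\<Sum>w\<in>\<Omega>. 1\<^sup>2) * (\<Sum>w\<in>\<Omega>. \<bar>F w\<bar>\<^sup>2)"
    by (rule Cauchy_Schwarz_ineq_sum)
  also have "\<dots> = real (card \<Omega>) * (\<Sum>w\<in>\<Omega>. F w * F w)" by (simp add: power2_eq_square)
  also have "\<dots> \<le> real (card \<Omega>) * (real (card R) * \<nu>)"
    by (intro mult_left_mono F) simp
  finally have L1: "(\<Sum>w\<in>\<Omega>. \<bar>F w\<bar>) \<le> sqrt (real (card \<Omega>) * (real (card R) * \<nu>))"
    by (intro real_le_rsqrt) simp
  have "(\<Sum>r\<in>R. \<bar>\<Sum>w\<in>\<Omega>. D w * \<phi> r w\<bar>) = (\<Sum>r\<in>R. \<Sum>w\<in>\<Omega>. e r * (D w * \<phi> r w))"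
    unfolding sum_distrib_left [symmetric] by (simp add: e_def abs_sgn mult.commute)
  also have "\<dots> = (\<Sum>w\<in>\<Omega>. D w * F w)"
    by (subst sum.swap) (simp add: F_def sum_distrib_left mult_ac)
  also have "\<dots> \<le> (\<Sum>w\<in>\<Omega>. S * \<bar>F w\<bar>)"
  proof (rule sum_mono)
    fix w assume "w \<in> \<Omega>"
    have "D w * F w \<le> \<bar>D w\<bar> * \<bar>F w\<bar>" by (simp flip: abs_mult)
    also have "\<dots> \<le> S * \<bar>F w\<bar>" using D [OF \<open>w \<in> \<Omega>\<close>] by (intro mult_right_mono) auto
    finally show "D w * F w \<le> S * \<bar>F w\<bar>" .
  qed
  also have "\<dots> = S * (\<Sum>w\<in>\<Omega>. \<bar>F w\<bar>)" by (simp add: sum_distrib_left)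
  also have "\<dots> \<le> S * sqrt (real (card \<Omega>) * (real (card R) * \<nu>))"
    by (intro mult_left_mono L1 S)
  finally show ?thesis .
qed

text \<open>If two terms are active, every summand on the left is nonpositive; if at most one is,
  no cancellation is possible on the right.\<close>

lemma isolated_sum_le_abs_sum:
  fixes \<eta> w :: "'s \<Rightarrow> real" and P :: "'s \<Rightarrow> bool"
  assumes fin: "finite S" and \<eta>: "\<And>s. s \<in> S \<Longrightarrow> \<bar>\<eta> s\<bar> = 1"
    and w: "\<And>s. s \<in> S \<Longrightarrow> 0 \<le> w s" "\<And>s. s \<in> S \<Longrightarrow> \<not> P s \<Longrightarrow> w s = 0"
  shows "(\<Sum>s\<in>S. w s * (1 - (\<Sum>s'\<in>S - {s}. of_bool (P s')))) \<le> \<bar>\<Sum>s\<in>S. \<eta> s * w s\<bar>"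
proof (cases "\<exists>a\<in>S. \<exists>b\<in>S. a \<noteq> b \<and> P a \<and> P b")
  case True
  then obtain a b where ab: "a \<in> S" "b \<in> S" "a \<noteq> b" "P a" "P b" by blast
  have "(\<Sum>s\<in>S. w s * (1 - (\<Sum>s'\<in>S - {s}. of_bool (P s')))) \<le> 0"
  proof (intro sum_nonpos mult_nonneg_nonpos w)
    fix s assume "s \<in> S"
    obtain c where c: "c \<in> S - {s}" "P c" using ab by (cases "a = s") auto
    have "(\<Sum>s'\<in>{c}. of_bool (P s')) \<le> (\<Sum>s'\<in>S - {s}. of_bool (P s') :: real)"
      using c fin by (intro sum_mono2) auto
    then show "1 - (\<Sum>s'\<in>S - {s}. of_bool (P s')) \<le> (0 :: real)" using c by simp
  qed
  then show ?thesis by linarith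
next
  case False
  show ?thesis
  proof (cases "\<exists>a\<in>S. P a")
    case True
    then obtain a where a: "a \<in> S" "P a" by blast
    have z: "w s = 0" if "s \<in> S - {a}" for s using that False a w(2) by blast
    have "(\<Sum>s'\<in>S - {a}. of_bool (P s')) = (0 :: real)"
      using False a by (intro sum.neutral) auto
    then have "(\<Sum>s\<in>S. w s * (1 - (\<Sum>s'\<in>S - {s}. of_bool (P s')))) = w a"
      using fin a z by (simp add: sum.remove [of S a])
    moreover have "(\<Sum>s\<in>S. \<eta> s * w s) = \<eta> a * w a"
      using fin a z by (simp add: sum.remove [of S a])
    ultimately show ?thesis using \<eta> [of a] w(1) [of a] a by (simp add: abs_mult)
  next
    case False
    then have "w s = 0" if "s \<in> S" for s using w(2) that by blast
    then show ?thesis by simp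
  qed
qed

section \<open>Rectangles of complementary scales and isolated points\<close>

text \<open>There are \<open>2 ^ K\<close> times but \<open>2 ^ (K + 2)\<close> cells. A rectangle
  spans \<open>2 ^ (a + 1)\<close> times and a fraction \<open>1 / 2 ^ (a + 2)\<close> of the cells,
  whence the mean of one half point at every scale.\<close>

definition rectangles :: "nat \<Rightarrow> (nat \<times> nat \<times> nat) set" where
  "rectangles K = (SIGMA a:{..<K}. {..<2 ^ (K - 1 - a)} \<times> {..<2 ^ (a + 2)})"

definition rect_haar :: "nat \<Rightarrow> nat \<times> nat \<times> nat \<Rightarrow> nat \<times> nat \<Rightarrow> real" where
  "rect_haar K = (\<lambda>(a, i, j) (t, m). haar (a, i) t * haar (K - 1 - a, j) m)"

lemma rectanglesE:
  assumes "r \<in> rectangles K"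
  obtains a i j where "r = (a, i, j)" "a < K" "i < 2 ^ (K - 1 - a)" "j < 2 ^ (a + 2)"
  using assms by (auto simp: rectangles_def)

lemma finite_rectangles [simp]: "finite (rectangles K)"
  by (simp add: rectangles_def)

lemma card_rectangles: "card (rectangles K) = K * 2 ^ (K + 1)"
proof -
  have "card (rectangles K) = (\<Sum>a<K. 2 ^ (K - 1 - a) * 2 ^ (a + 2))"
    unfolding rectangles_def by (subst card_SigmaI) auto
  also have "\<dots> = (\<Sum>a<K. 2 ^ (K + 1))"
    by (intro sum.cong refl) (simp flip: power_add del: power_Suc)
  finally show ?thesis by simp
qed

lemma rect_haar_inner:
  "(\<Sum>w\<in>{..<2 ^ K} \<times> {..<2 ^ (K + 2)}. rect_haar K (a, i, j) w * rect_haar K (a', i', j') w)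
     = (\<Sum>t<2 ^ K. haar (a, i) t * haar (a', i') t) *
       (\<Sum>m<2 ^ (K + 2). haar (K - 1 - a, j) m * haar (K - 1 - a', j') m)"
  unfolding sum_product sum.cartesian_product
  by (intro sum.cong refl) (auto simp: rect_haar_def)

text \<open>If the time indices \<open>(a, i)\<close> differ, the time factor vanishes. Otherwise
  the space scales agree and \<open>j\<close> differs, so the space factor vanishes.\<close>

lemma rect_haar_orthogonal:
  assumes r: "r \<in> rectangles K" "r' \<in> rectangles K" "r \<noteq> r'"
  shows "(\<Sum>w\<in>{..<2 ^ K} \<times> {..<2 ^ (K + 2)}. rect_haar K r w * rect_haar K r' w) = 0"
proof -
  obtain a i j where 1: "r = (a, i, j)" "a < K" using r(1) by (elim rectanglesE)
  obtain a' i' j' where 2: "r' = (a', i', j')" "a' < K" using r(2) by (elim rectanglesE)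
  show ?thesis
  proof (cases "(a, i) = (a', i')")
    case False
    then have "(\<Sum>t<2 ^ K. haar (a, i) t * haar (a', i') t) = 0"
      using 1 2 by (intro haar_orthogonal) auto
    then show ?thesis by (simp only: 1 2 rect_haar_inner mult_zero_left)
  next
    case True
    then have "(\<Sum>m<2 ^ (K + 2). haar (K - 1 - a, j) m * haar (K - 1 - a', j') m) = 0"
      using r 1 2 by (intro haar_orthogonal) auto
    then show ?thesis by (simp only: 1 2 rect_haar_inner mult_zero_right)
  qed
qed

lemma rect_haar_norm:
  assumes r: "r \<in> rectangles K"
  shows "(\<Sum>w\<in>{..<2 ^ K} \<times> {..<2 ^ (K + 2)}. rect_haar K r w * rect_haar K r w) = 2 ^ (K + 1)"
proof -
  obtain a i j where 1: "r = (a, i, j)" "a < K" "i < 2 ^ (K - 1 - a)" "j < 2 ^ (a + 2)"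
    using r by (elim rectanglesE)
  have "K + 2 - 1 - (K - 1 - a) = a + 2" using 1 by simp
  then have "(\<Sum>m<2 ^ (K + 2). \<bar>haar (K - 1 - a, j) m\<bar>) = 2 ^ Suc (K - 1 - a)"
    using 1 by (intro sum_abs_haar) auto
  moreover have "(\<Sum>t<2 ^ K. \<bar>haar (a, i) t\<bar>) = 2 ^ Suc a"
    using 1 by (intro sum_abs_haar) auto
  moreover have "2 ^ Suc a * 2 ^ Suc (K - 1 - a) = (2 ^ (K + 1) :: real)"
    unfolding power_add [symmetric] using 1 by (intro arg_cong [where f = "power 2"]) simp
  ultimately show ?thesis unfolding 1 rect_haar_inner haar_mult_self by simp
qed

lemma sum_mult_sum_Times:
  fixes f :: "'a \<Rightarrow> real" and g :: "'b \<Rightarrow> real"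
  shows "(\<Sum>i\<in>A. f i) * (\<Sum>j\<in>B. g j) = (\<Sum>p\<in>A \<times> B. f (fst p) * g (snd p))"
  by (simp add: sum_product sum.cartesian_product case_prod_beta)

text \<open>The coefficient with which a point at time \<open>s\<close> in cell \<open>u\<close>
  enters the Haar coefficient of the rectangle. The minus signs from time and space cancel, so it is
  nonnegative.\<close>

definition rect_weight :: "nat \<Rightarrow> nat \<times> nat \<times> nat \<Rightarrow> nat \<Rightarrow> nat \<Rightarrow> real" where
  "rect_weight K = (\<lambda>(a, i, j) s u. tent (a, i) s * tent (K - 1 - a, j) u)"

definition in_rect :: "nat \<Rightarrow> nat \<times> nat \<times> nat \<Rightarrow> nat \<Rightarrow> nat \<Rightarrow> bool" where
  "in_rect K = (\<lambda>(a, i, j) s u. s div 2 ^ Suc a = i \<and> u div 2 ^ Suc (K - 1 - a) = j)"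

text \<open>No signs occur, so a lower bound on this quantity serves all signings at once. The
  bracket is 1 for an isolated point and at most 0 if another point shares the rectangle; being
  linear in the other points, it needs only pairwise independence in expectation.\<close>

definition isolated_mass :: "nat \<Rightarrow> (nat \<Rightarrow> nat) \<Rightarrow> real" where
  "isolated_mass K u = (\<Sum>r\<in>rectangles K. \<Sum>s<2 ^ K. rect_weight K r s (u s) *
     (1 - (\<Sum>s'\<in>{..<2 ^ K} - {s}. of_bool (in_rect K r s' (u s')))))"

lemma rect_weight_nonneg: "0 \<le> rect_weight K r s u"
  by (cases r) (simp add: rect_weight_def tent_nonneg)

lemma rect_weight_eq_0:
  assumes "\<not> in_rect K r s u"
  shows "rect_weight K r s u = 0"
proof -
  obtain a i j where r: "r = (a, i, j)" by (cases r) auto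
  have "tent (a, i) s = 0 \<or> tent (K - 1 - a, j) u = 0"
    using assms tent_le [of a i s] tent_le [of "K - 1 - a" j u] tent_nonneg [of "(a, i)" s]
      tent_nonneg [of "(K - 1 - a, j)" u]
    by (auto simp: in_rect_def r of_bool_def simp del: power_Suc split: if_splits)
  then show ?thesis by (auto simp: rect_weight_def r)
qed

definition box_disc :: "nat \<Rightarrow> (nat \<Rightarrow> real) \<Rightarrow> (nat \<Rightarrow> nat) \<Rightarrow> nat \<times> nat \<Rightarrow> real" where
  "box_disc K \<eta> u = (\<lambda>(t, m). \<Sum>s<2 ^ K. \<eta> s * (of_bool (s \<le> t) * of_bool (u s \<le> m)))"

lemma box_disc_inner:
  assumes r: "r \<in> rectangles K" and u: "\<And>s. u s < 2 ^ (K + 2)"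
  shows "(\<Sum>w\<in>{..<2 ^ K} \<times> {..<2 ^ (K + 2)}. box_disc K \<eta> u w * rect_haar K r w)
     = (\<Sum>s<2 ^ K. \<eta> s * rect_weight K r s (u s))"
proof -
  obtain a i j where 1: "r = (a, i, j)" "a < K" using r by (elim rectanglesE)
  have "(\<Sum>w\<in>{..<2 ^ K} \<times> {..<2 ^ (K + 2)}. box_disc K \<eta> u w * rect_haar K r w)
      = (\<Sum>w\<in>{..<2 ^ K} \<times> {..<2 ^ (K + 2)}. \<Sum>s<2 ^ K. \<eta> s * ((haar (a, i) (fst w) * of_bool (s \<le> fst w)) *
          (haar (K - 1 - a, j) (snd w) * of_bool (u s \<le> snd w))))"
    unfolding box_disc_def rect_haar_def 1
    by (intro sum.cong refl) (simp add: case_prod_beta sum_distrib_left sum_distrib_right mult_ac)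
  also have "\<dots> = (\<Sum>s<2 ^ K. \<Sum>w\<in>{..<2 ^ K} \<times> {..<2 ^ (K + 2)}. \<eta> s * ((haar (a, i) (fst w) * of_bool (s \<le> fst w)) *
          (haar (K - 1 - a, j) (snd w) * of_bool (u s \<le> snd w))))"
    by (rule sum.swap)
  also have "\<dots> = (\<Sum>s<2 ^ K. \<eta> s * ((\<Sum>t<2 ^ K. haar (a, i) t * of_bool (s \<le> t)) *
          (\<Sum>m<2 ^ (K + 2). haar (K - 1 - a, j) m * of_bool (u s \<le> m))))"
    unfolding sum_mult_sum_Times by (simp only: sum_distrib_left)
  also have "\<dots> = (\<Sum>s<2 ^ K. \<eta> s * rect_weight K r s (u s))"
  proof (intro sum.cong refl)
    fix s assume "s \<in> {..<(2::nat) ^ K}"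
    then have "(\<Sum>t<2 ^ K. haar (a, i) t * of_bool (s \<le> t)) = - tent (a, i) s"
      using 1 by (intro sum_haar_mult_ge) auto
    moreover have "(\<Sum>m<2 ^ (K + 2). haar (K - 1 - a, j) m * of_bool (u s \<le> m)) = - tent (K - 1 - a, j) (u s)"
      using 1 u by (intro sum_haar_mult_ge) auto
    ultimately show "\<eta> s * ((\<Sum>t<2 ^ K. haar (a, i) t * of_bool (s \<le> t)) *
          (\<Sum>m<2 ^ (K + 2). haar (K - 1 - a, j) m * of_bool (u s \<le> m))) = \<eta> s * rect_weight K r s (u s)"
      by (simp add: rect_weight_def 1)
  qed
  finally show ?thesis .
qed

text \<open>On each rectangle the isolated mass is at most the absolute Haar coefficient of the
  two-dimensional prefix discrepancy; orthogonality bounds the sum of these coefficients by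
  duality.\<close>

lemma isolated_mass_le_box_disc:
  assumes u: "\<And>s. u s < 2 ^ (K + 2)" and \<eta>: "\<And>s. s < 2 ^ K \<Longrightarrow> \<bar>\<eta> s\<bar> = 1"
    and S: "\<And>w. w \<in> {..<2 ^ K} \<times> {..<2 ^ (K + 2)} \<Longrightarrow> \<bar>box_disc K \<eta> u w\<bar> \<le> S" "0 \<le> S"
  shows "isolated_mass K u \<le> S * (4 * 4 ^ K * sqrt (real K))"
proof -
  let ?\<Omega> = "{..<(2::nat) ^ K} \<times> {..<(2::nat) ^ (K + 2)}"
  have "isolated_mass K u \<le> (\<Sum>r\<in>rectangles K. \<bar>\<Sum>s<2 ^ K. \<eta> s * rect_weight K r s (u s)\<bar>)"
    unfolding isolated_mass_def
    by (intro sum_mono isolated_sum_le_abs_sum) (auto simp: \<eta> rect_weight_nonneg rect_weight_eq_0)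
  also have "\<dots> = (\<Sum>r\<in>rectangles K. \<bar>\<Sum>w\<in>?\<Omega>. box_disc K \<eta> u w * rect_haar K r w\<bar>)"
    by (intro sum.cong refl) (simp only: box_disc_inner [OF _ u])
  also have "\<dots> \<le> S * sqrt (real (card ?\<Omega>) * (real (card (rectangles K)) * 2 ^ (K + 1)))"
    by (rule sum_abs_inner_le [OF finite_rectangles _ rect_haar_orthogonal
          order_eq_refl [OF rect_haar_norm] S]) auto
  \<comment> \<open>There are \<open>4 * 4 ^ K\<close> grid points and
    \<open>K * 2 ^ (K + 1)\<close> rectangles, each with squared norm
    \<open>2 ^ (K + 1)\<close>.\<close>
  also have "real (card ?\<Omega>) * (real (card (rectangles K)) * 2 ^ (K + 1)) = (4 * 4 ^ K)\<^sup>2 * real K"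
  proof -
    have "(4::real) ^ K = 2 ^ K * 2 ^ K" by (simp flip: power_mult_distrib)
    then show ?thesis
      unfolding card_rectangles by (simp add: power_add power2_eq_square)
  qed
  also have "sqrt ((4 * 4 ^ K)\<^sup>2 * real K) = 4 * 4 ^ K * sqrt (real K)"
    by (simp add: real_sqrt_mult)
  finally show ?thesis .
qed

lemma sum_tent_level_le: "(\<Sum>i<M. tent (l, i) u) \<le> 2 ^ l"
proof -
  have "(\<Sum>i<M. tent (l, i) u) \<le> (\<Sum>i<M. if i = u div 2 ^ Suc l then 2 ^ l else 0)"
    by (intro sum_mono order_trans [OF tent_le]) auto
  also have "\<dots> \<le> 2 ^ l" by (simp add: sum.delta del: power_Suc)
  finally show ?thesis .
qed

text \<open>For each scale a point lies in at most one rectangle, where its weight is at most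
  \<open>2 ^ a * 2 ^ (K - 1 - a)\<close>. This deterministic ceiling is what the reverse Markov
  inequality requires.\<close>

lemma isolated_mass_le: "isolated_mass K u \<le> real K * 4 ^ K / 2"
proof -
  have "isolated_mass K u \<le> (\<Sum>r\<in>rectangles K. \<Sum>s<2 ^ K. rect_weight K r s (u s))"
    unfolding isolated_mass_def
  proof (intro sum_mono)
    fix r s
    have "0 \<le> (\<Sum>s'\<in>{..<2 ^ K} - {s}. of_bool (in_rect K r s' (u s')) :: real)"
      by (intro sum_nonneg) simp
    then show "rect_weight K r s (u s) * (1 - (\<Sum>s'\<in>{..<2 ^ K} - {s}. of_bool (in_rect K r s' (u s'))))
        \<le> rect_weight K r s (u s)"
      using rect_weight_nonneg [of K r s "u s"] by (intro mult_left_le) auto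
  qed
  also have "\<dots> = (\<Sum>s<2 ^ K. \<Sum>r\<in>rectangles K. rect_weight K r s (u s))"
    by (rule sum.swap)
  also have "\<dots> = (\<Sum>s<2 ^ K. \<Sum>a<K. (\<Sum>i<2 ^ (K - 1 - a). tent (a, i) s) * (\<Sum>j<2 ^ (a + 2). tent (K - 1 - a, j) (u s)))"
    unfolding rectangles_def sum_mult_sum_Times
    by (rule sum.cong [OF refl], subst sum.Sigma) (auto simp: rect_weight_def case_prod_beta)
  also have "\<dots> \<le> (\<Sum>s<(2::nat) ^ K. \<Sum>a<K. 2 ^ a * 2 ^ (K - 1 - a))"
    by (intro sum_mono mult_mono sum_tent_level_le sum_nonneg) (auto simp: tent_nonneg)
  also have "\<dots> = (\<Sum>s<(2::nat) ^ K. \<Sum>a<K. 2 ^ K / 2)"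
  proof (intro sum.cong refl)
    fix a assume "a \<in> {..<K}"
    then have "2 * ((2::real) ^ a * 2 ^ (K - 1 - a)) = 2 ^ K"
      by (simp flip: power_add power_Suc)
    then show "(2::real) ^ a * 2 ^ (K - 1 - a) = 2 ^ K / 2" by simp
  qed
  also have "\<dots> = real K * 4 ^ K / 2"
  proof -
    have "(4::real) ^ K = 2 ^ K * 2 ^ K" by (simp flip: power_mult_distrib)
    then show ?thesis by simp
  qed
  finally show ?thesis .
qed

section \<open>Expectation of the isolated mass\<close>

lemma
  fixes f g :: "nat \<Rightarrow> real"
  assumes s: "s \<in> {1..T}" "s' \<in> {1..T}" "s \<noteq> s'"
  shows integrable_points_pair: "integrable (points T) (\<lambda>x. f (cell N (x s)) * g (cell N (x s')))"
    and integral_points_pair: "(\<integral>x. f (cell N (x s)) * g (cell N (x s')) \<partial>points T)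
      = ((\<Sum>u<2 ^ N. f u) / 2 ^ N) * ((\<Sum>u<2 ^ N. g u) / 2 ^ N)"
proof -
  interpret U: prob_space unif by (rule prob_space_unif)
  interpret product_sigma_finite "\<lambda>_. unif" ..
  \<comment> \<open>Padding with factors 1 writes the expression as a product over all coordinates,
    which the product measure integrates factor by factor.\<close>
  define F where "F i u = (if i = s then f u else 1) * (if i = s' then g u else 1)" for i u
  have eq: "f (cell N (x s)) * g (cell N (x s')) = (\<Prod>i\<in>{1..T}. F i (cell N (x i)))" for x
    unfolding F_def prod.distrib using s by simp
  show "integrable (points T) (\<lambda>x. f (cell N (x s)) * g (cell N (x s')))"
    unfolding eq points_def by (rule product_integrable_prod) (auto intro: integrable_cell)
  have "(\<integral>x. f (cell N (x s)) * g (cell N (x s')) \<partial>points T) = (\<Prod>i\<in>{1..T}. (\<Sum>u<2 ^ N. F i u) / 2 ^ N)"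
    unfolding eq points_def by (subst product_integral_prod) (auto intro: integrable_cell simp: integral_cell)
  also have "\<dots> = (\<Prod>i\<in>{1..T}. (if i = s then (\<Sum>u<2 ^ N. f u) / 2 ^ N else 1) *
      (if i = s' then (\<Sum>u<2 ^ N. g u) / 2 ^ N else 1))"
    unfolding F_def using s by (intro prod.cong refl) auto
  also have "\<dots> = ((\<Sum>u<2 ^ N. f u) / 2 ^ N) * ((\<Sum>u<2 ^ N. g u) / 2 ^ N)"
    unfolding prod.distrib using s by simp
  finally show "(\<integral>x. f (cell N (x s)) * g (cell N (x s')) \<partial>points T)
      = ((\<Sum>u<2 ^ N. f u) / 2 ^ N) * ((\<Sum>u<2 ^ N. g u) / 2 ^ N)" .
qed

lemma
  fixes f :: "nat \<Rightarrow> real"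
  assumes s: "s \<in> {1..T}"
  shows integrable_points_cell: "integrable (points T) (\<lambda>x. f (cell N (x s)))"
    and integral_points_cell: "(\<integral>x. f (cell N (x s)) \<partial>points T) = (\<Sum>u<2 ^ N. f u) / 2 ^ N"
proof -
  interpret U: prob_space unif by (rule prob_space_unif)
  interpret product_sigma_finite "\<lambda>_. unif" ..
  define F where "F i u = (if i = s then f u else 1)" for i u
  have eq: "f (cell N (x s)) = (\<Prod>i\<in>{1..T}. F i (cell N (x i)))" for x
    unfolding F_def using s by simp
  show "integrable (points T) (\<lambda>x. f (cell N (x s)))"
    unfolding eq points_def by (rule product_integrable_prod) (auto intro: integrable_cell)
  have "(\<integral>x. f (cell N (x s)) \<partial>points T) = (\<Prod>i\<in>{1..T}. (\<Sum>u<2 ^ N. F i u) / 2 ^ N)"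
    unfolding eq points_def by (subst product_integral_prod) (auto intro: integrable_cell simp: integral_cell)
  also have "\<dots> = (\<Prod>i\<in>{1..T}. (if i = s then (\<Sum>u<2 ^ N. f u) / 2 ^ N else 1))"
    unfolding F_def using s by (intro prod.cong refl) auto
  also have "\<dots> = (\<Sum>u<2 ^ N. f u) / 2 ^ N"
    using s by simp
  finally show "(\<integral>x. f (cell N (x s)) \<partial>points T) = (\<Sum>u<2 ^ N. f u) / 2 ^ N" .
qed

text \<open>By independence, expecting the other points of the time block to hit the rectangle costs
  at most half of the weight. What remains of each rectangle is at least
  \<open>4 ^ (K - 1) / 2 ^ (K + 3)\<close>, and there are \<open>K * 2 ^ (K + 1)\<close>
  rectangles.\<close>

lemma isolated_mass_expectation:
  assumes T: "2 ^ K \<le> T"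
  shows integrable_isolated_mass:
      "integrable (points T) (\<lambda>x. isolated_mass K (\<lambda>s. cell (K + 2) (x (Suc s))))"
    and integral_isolated_mass_ge:
      "real K * 4 ^ K / 16 \<le> (\<integral>x. isolated_mass K (\<lambda>s. cell (K + 2) (x (Suc s))) \<partial>points T)"
proof -
  let ?N = "K + 2"
  let ?z = "\<lambda>x s. cell ?N (x (Suc s))"
  let ?w = "\<lambda>r s x. rect_weight K r s (?z x s)"
  let ?v = "\<lambda>r s x. of_bool (in_rect K r s (?z x s)) :: real"
  \<comment> \<open>Points are numbered from 1, whereas the Haar functions in time live on
    \<open>{..<2 ^ K}\<close>; hence the shift by \<open>Suc\<close>.\<close>
  have idx: "Suc s \<in> {1..T}" if "s < 2 ^ K" for s using that T by auto
  have int1: "integrable (points T) (?w r s)" if "s < 2 ^ K" for r s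
    using integrable_points_cell [OF idx [OF that]] .
  have int2: "integrable (points T) (\<lambda>x. ?w r s x * ?v r s' x)"
    if "s < 2 ^ K" "s' \<in> {..<2 ^ K} - {s}" for r s s'
    using that by (intro integrable_points_pair idx) auto
  have eq: "isolated_mass K (?z x) = (\<Sum>r\<in>rectangles K. \<Sum>s<2 ^ K. ?w r s x -
      (\<Sum>s'\<in>{..<2 ^ K} - {s}. ?w r s x * ?v r s' x))" for x
    unfolding isolated_mass_def sum_distrib_left [symmetric] by (simp add: algebra_simps)
  have int3: "integrable (points T) (\<lambda>x. \<Sum>s'\<in>{..<2 ^ K} - {s}. ?w r s x * ?v r s' x)" if "s < 2 ^ K" for r s
    using that by (intro Bochner_Integration.integrable_sum int2) auto
  show "integrable (points T) (\<lambda>x. isolated_mass K (?z x))"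
    unfolding eq by (intro Bochner_Integration.integrable_sum Bochner_Integration.integrable_diff int1 int2) auto
  have sum1: "(\<integral>x. ?w r s x - (\<Sum>s'\<in>{..<2 ^ K} - {s}. ?w r s x * ?v r s' x) \<partial>points T)
      = (\<integral>x. ?w r s x \<partial>points T) - (\<Sum>s'\<in>{..<2 ^ K} - {s}. (\<integral>x. ?w r s x * ?v r s' x \<partial>points T))"
    if "s < 2 ^ K" for r s
    unfolding Bochner_Integration.integral_diff [OF int1 [OF that] int3 [OF that]]
    by (subst Bochner_Integration.integral_sum [OF int2 [OF that]]) auto
  have "(\<integral>x. isolated_mass K (?z x) \<partial>points T) = (\<Sum>r\<in>rectangles K. \<integral>x. (\<Sum>s<2 ^ K. ?w r s x -
      (\<Sum>s'\<in>{..<2 ^ K} - {s}. ?w r s x * ?v r s' x)) \<partial>points T)"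
    unfolding eq
    by (intro Bochner_Integration.integral_sum Bochner_Integration.integrable_sum Bochner_Integration.integrable_diff int1 int2) auto
  also have "\<dots> = (\<Sum>r\<in>rectangles K. \<Sum>s<2 ^ K. \<integral>x. ?w r s x -
      (\<Sum>s'\<in>{..<2 ^ K} - {s}. ?w r s x * ?v r s' x) \<partial>points T)"
    by (intro sum.cong refl Bochner_Integration.integral_sum Bochner_Integration.integrable_diff int1 int3) auto
  also have "\<dots> = (\<Sum>r\<in>rectangles K. \<Sum>s<2 ^ K. (\<integral>x. ?w r s x \<partial>points T) -
      (\<Sum>s'\<in>{..<2 ^ K} - {s}. (\<integral>x. ?w r s x * ?v r s' x \<partial>points T)))"
    by (intro sum.cong refl sum1) auto
  also have "\<dots> \<ge> (\<Sum>r\<in>rectangles K. 4 ^ (K - 1) / 2 ^ (K + 3))"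
  proof (intro sum_mono)
    fix r assume "r \<in> rectangles K"
    then obtain a i j where r: "r = (a, i, j)" "a < K" "i < 2 ^ (K - 1 - a)" "j < 2 ^ (a + 2)"
      by (elim rectanglesE)
    define l where "l = K - 1 - a"
    define \<tau> where "\<tau> = (\<Sum>u<2 ^ ?N. tent (l, j) u) / 2 ^ ?N"
    have l: "?N - 1 - l = a + 2" "l < ?N" "Suc l + (a + 1) = ?N - 1" "a + l = K - 1" using r by (auto simp: l_def)
    have \<tau>: "4 ^ l / 2 ^ ?N \<le> \<tau>"
      using sum_tent_ge [of l ?N j] l r unfolding \<tau>_def
      by (intro divide_right_mono) (auto simp flip: power_mult_distrib)
    have \<tau>0: "0 \<le> \<tau>" unfolding \<tau>_def by (intro divide_nonneg_nonneg sum_nonneg tent_nonneg) auto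
    have w: "(\<Sum>u<2 ^ ?N. rect_weight K r s u) / 2 ^ ?N = tent (a, i) s * \<tau>" for s
      by (simp add: rect_weight_def r \<tau>_def l_def flip: sum_distrib_left)
    have v: "(\<Sum>u<2 ^ ?N. of_bool (in_rect K r s' u) :: real) / 2 ^ ?N = of_bool (s' div 2 ^ Suc a = i) / 2 ^ (a + 2)" for s'
    proof -
      have "(\<Sum>u<2 ^ ?N. of_bool (u div 2 ^ Suc l = j) :: real) = (\<Sum>u<2 ^ ?N. \<bar>haar (l, j) u\<bar>)"
        by (intro sum.cong) (auto simp: haar_def)
      also have "\<dots> = 2 ^ Suc l" using r l by (intro sum_abs_haar) auto
      finally have *: "(\<Sum>u<2 ^ ?N. of_bool (u div 2 ^ Suc l = j) :: real) = 2 ^ Suc l" .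
      have "(\<Sum>u<2 ^ ?N. of_bool (in_rect K r s' u) :: real)
          = (\<Sum>u<2 ^ ?N. of_bool (s' div 2 ^ Suc a = i) * of_bool (u div 2 ^ Suc l = j))"
        by (intro sum.cong refl) (auto simp: in_rect_def r l_def)
      also have "\<dots> = of_bool (s' div 2 ^ Suc a = i) * 2 ^ Suc l"
        by (simp only: * flip: sum_distrib_left)
      finally have "(\<Sum>u<2 ^ ?N. of_bool (in_rect K r s' u) :: real) = of_bool (s' div 2 ^ Suc a = i) * 2 ^ Suc l" .
      moreover have "(2::real) ^ ?N = 2 ^ Suc l * 2 ^ (a + 2)"
        unfolding power_add [symmetric] using l by (intro arg_cong [where f = "power 2"]) simp
      ultimately show ?thesis by (simp del: power_Suc power_add)
    qed
    \<comment> \<open>At most \<open>2 ^ (a + 1)\<close> other times lie in the block, and each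
      point hits the space side with probability \<open>1 / 2 ^ (a + 2)\<close>.\<close>
    have blk: "(\<Sum>s'\<in>{..<2 ^ K} - {s}. of_bool (s' div 2 ^ Suc a = i) / 2 ^ (a + 2)) \<le> (1 / 2 :: real)" for s
    proof -
      have "(\<Sum>s'\<in>{..<2 ^ K} - {s}. of_bool (s' div 2 ^ Suc a = i) / 2 ^ (a + 2))
          \<le> (\<Sum>s'<2 ^ K. of_bool (s' div 2 ^ Suc a = i) / 2 ^ (a + 2) :: real)"
        by (intro sum_mono2) auto
      also have "\<dots> = (\<Sum>s'<2 ^ K. \<bar>haar (a, i) s'\<bar>) / 2 ^ (a + 2)"
        unfolding sum_divide_distrib by (intro sum.cong) (auto simp: haar_def)
      also have "\<dots> = 1 / 2" using r by (subst sum_abs_haar) auto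
      finally show ?thesis .
    qed
    have ge: "tent (a, i) s * \<tau> * (1 / 2) \<le> (\<integral>x. ?w r s x \<partial>points T) -
        (\<Sum>s'\<in>{..<2 ^ K} - {s}. (\<integral>x. ?w r s x * ?v r s' x \<partial>points T))" if s: "s < 2 ^ K" for s
    proof -
      have "(\<Sum>s'\<in>{..<2 ^ K} - {s}. (\<integral>x. ?w r s x * ?v r s' x \<partial>points T))
          = (\<Sum>s'\<in>{..<2 ^ K} - {s}. (tent (a, i) s * \<tau>) * (of_bool (s' div 2 ^ Suc a = i) / 2 ^ (a + 2)))"
      proof (intro sum.cong refl)
        fix s' assume s': "s' \<in> {..<2 ^ K} - {s}"
        have "(\<integral>x. ?w r s x * ?v r s' x \<partial>points T) = ((\<Sum>u<2 ^ ?N. rect_weight K r s u) / 2 ^ ?N) *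
            ((\<Sum>u<2 ^ ?N. of_bool (in_rect K r s' u)) / 2 ^ ?N)"
          using s s' by (intro integral_points_pair idx) auto
        then show "(\<integral>x. ?w r s x * ?v r s' x \<partial>points T)
            = (tent (a, i) s * \<tau>) * (of_bool (s' div 2 ^ Suc a = i) / 2 ^ (a + 2))"
          unfolding w v .
      qed
      also have "\<dots> \<le> (tent (a, i) s * \<tau>) * (1 / 2)"
        unfolding sum_distrib_left [symmetric]
        by (intro mult_left_mono blk mult_nonneg_nonneg tent_nonneg \<tau>0)
      finally have "(\<Sum>s'\<in>{..<2 ^ K} - {s}. (\<integral>x. ?w r s x * ?v r s' x \<partial>points T))
          \<le> (tent (a, i) s * \<tau>) * (1 / 2)" .
      moreover have "(\<integral>x. ?w r s x \<partial>points T) = tent (a, i) s * \<tau>"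
        using integral_points_cell [OF idx [OF s], of "rect_weight K r s" ?N] unfolding w .
      ultimately show ?thesis by linarith
    qed
    \<comment> \<open>The time and space tents have mass at least \<open>4 ^ a\<close> and
      \<open>4 ^ l\<close>. As \<open>a + l = K - 1\<close>, the product does not depend on the
      scale.\<close>
    have "4 ^ (K - 1) / 2 ^ (K + 3) = (2 ^ a * 2 ^ a) * (4 ^ l / 2 ^ ?N) * (1 / 2 :: real)"
    proof -
      have "(4::real) ^ (K - 1) = 4 ^ a * 4 ^ l" using l by (simp flip: power_add)
      moreover have "(2::real) ^ a * 2 ^ a = 4 ^ a" by (simp flip: power_mult_distrib)
      moreover have "(2::real) ^ (K + 3) = 2 ^ ?N * 2" by (simp add: power_add)
      ultimately show ?thesis by simp
    qed
    also have "\<dots> \<le> (\<Sum>s<2 ^ K. tent (a, i) s) * \<tau> * (1 / 2)"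
      using sum_tent_ge [of a K i] r \<tau> by (intro mult_mono) (auto simp: tent_nonneg intro!: sum_nonneg mult_nonneg_nonneg \<tau>0)
    also have "\<dots> = (\<Sum>s<2 ^ K. tent (a, i) s * \<tau> * (1 / 2))"
      by (simp add: sum_distrib_right)
    also have "\<dots> \<le> (\<Sum>s<2 ^ K. (\<integral>x. ?w r s x \<partial>points T) -
        (\<Sum>s'\<in>{..<2 ^ K} - {s}. (\<integral>x. ?w r s x * ?v r s' x \<partial>points T)))"
      using ge by (intro sum_mono) auto
    finally show "4 ^ (K - 1) / 2 ^ (K + 3) \<le> (\<Sum>s<2 ^ K. (\<integral>x. ?w r s x \<partial>points T) -
        (\<Sum>s'\<in>{..<2 ^ K} - {s}. (\<integral>x. ?w r s x * ?v r s' x \<partial>points T)))" .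
  qed
  also have "(\<Sum>r\<in>rectangles K. 4 ^ (K - 1) / 2 ^ (K + 3)) = real K * 4 ^ K / (16 :: real)"
    by (cases K) (auto simp: card_rectangles power_add field_simps)
  finally show "real K * 4 ^ K / 16 \<le> (\<integral>x. isolated_mass K (?z x) \<partial>points T)" .
qed

text \<open>Off the event \<open>X\<close> is below \<open>\<mu> / 2\<close>, on it at most
  \<open>U\<close>; taking expectations leaves at least \<open>\<mu> / 2\<close> for
  \<open>U\<close> times the probability.\<close>

lemma (in prob_space) reverse_Markov:
  fixes X :: "'a \<Rightarrow> real"
  assumes X: "integrable M X" and le: "\<And>x. X x \<le> U" and U: "0 < U"
    and \<mu>: "\<mu> \<le> expectation X" "0 \<le> \<mu>"
  shows "\<mu> / (2 * U) \<le> prob {x \<in> space M. \<mu> / 2 \<le> X x}"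
proof -
  define E where "E = {x \<in> space M. \<mu> / 2 \<le> X x}"
  have [measurable]: "X \<in> borel_measurable M" using X by simp
  have E: "E \<in> events" unfolding E_def by measurable
  have int: "integrable M (\<lambda>x. U * indicator E x + \<mu> / 2)"
    using E by (intro Bochner_Integration.integrable_add integrable_mult_right integrable_real_indicator)
      (auto simp: emeasure_eq_measure)
  have "\<mu> \<le> expectation X" by (rule \<mu>)
  also have "\<dots> \<le> expectation (\<lambda>x. U * indicator E x + \<mu> / 2)"
  proof (rule integral_mono [OF X int])
    fix x assume "x \<in> space M"
    then show "X x \<le> U * indicator E x + \<mu> / 2"
      using le [of x] \<mu>(2) by (cases "x \<in> E") (auto simp: E_def)
  qed
  also have "\<dots> = U * prob E + \<mu> / 2"
    using E by (subst Bochner_Integration.integral_add) (auto simp: emeasure_eq_measure prob_space)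
  finally show ?thesis using U by (simp add: E_def field_simps)
qed

section \<open>The lower bound\<close>

lemma isolated_mass_le_max_disc:
  assumes T: "2 ^ K \<le> T" and x: "\<And>s. s \<in> {1..T} \<Longrightarrow> x s \<in> {0..1}"
    and \<sigma>: "\<And>s. s \<in> {1..T} \<Longrightarrow> \<bar>\<sigma> s\<bar> = 1"
  shows "isolated_mass K (\<lambda>s. cell (K + 2) (x (Suc s))) \<le> max_disc T \<sigma> x * (4 * 4 ^ K * sqrt (real K))"
proof (rule isolated_mass_le_box_disc)
  let ?u = "\<lambda>s. cell (K + 2) (x (Suc s))"
  show "?u s < 2 ^ (K + 2)" for s by (rule cell_less)
  show "\<bar>\<sigma> (Suc s)\<bar> = 1" if "s < 2 ^ K" for s using that T by (intro \<sigma>) auto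
  have T1: "1 \<in> {1..T}" using T order_trans [of 1 "2 ^ K" T] by simp
  show "0 \<le> max_disc T \<sigma> x"
    using disc_le_max_disc [OF T1 empty_in_unit_subintervals, of \<sigma> x] disc_nonneg by (rule order_trans [rotated])
  fix w :: "nat \<times> nat" assume "w \<in> {..<2 ^ K} \<times> {..<2 ^ (K + 2)}"
  then obtain t m where w: "w = (t, m)" "t < 2 ^ K" by auto
  \<comment> \<open>Monotonicity of \<open>cell\<close> makes this set of positions an interval; its
    discrepancy at time \<open>Suc t\<close> is the box discrepancy at
    \<open>(t, m)\<close>.\<close>
  define I where "I = {y \<in> {0..1}. cell (K + 2) y \<le> m}"
  have I: "I \<in> unit_subintervals"
    unfolding unit_subintervals_def I_def is_interval_1
    using cell_mono by (auto intro: order_trans)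
  have tT: "Suc t \<in> {1..T}" using w T by auto
  have "(\<Sum>s=1..Suc t. \<sigma> s * indicator I (x s)) = (\<Sum>s<Suc t. \<sigma> (Suc s) * indicator I (x (Suc s)))"
    by (rule sum.reindex_bij_witness [of _ Suc "\<lambda>s. s - 1"]) auto
  also have "\<dots> = (\<Sum>s<Suc t. \<sigma> (Suc s) * (of_bool (s \<le> t) * of_bool (?u s \<le> m)))"
  proof (intro sum.cong refl)
    fix s assume s: "s \<in> {..<Suc t}"
    then have "x (Suc s) \<in> {0..1}" using tT by (intro x) auto
    then have "indicator I (x (Suc s)) = (of_bool (?u s \<le> m) :: real)"
      unfolding I_def by (simp add: indicator_def)
    then show "\<sigma> (Suc s) * indicator I (x (Suc s)) = \<sigma> (Suc s) * (of_bool (s \<le> t) * of_bool (?u s \<le> m))"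
      using s by simp
  qed
  also have "\<dots> = box_disc K (\<lambda>s. \<sigma> (Suc s)) ?u w"
    unfolding box_disc_def w prod.case using w by (intro sum.mono_neutral_left) auto
  finally have "\<bar>box_disc K (\<lambda>s. \<sigma> (Suc s)) ?u w\<bar> = disc \<sigma> x (Suc t) I"
    by (simp only: disc_def)
  also have "\<dots> \<le> max_disc T \<sigma> x" by (rule disc_le_max_disc [OF tT I])
  finally show "\<bar>box_disc K (\<lambda>s. \<sigma> (Suc s)) ?u w\<bar> \<le> max_disc T \<sigma> x" .
qed

lemma log_2_floor_bounds:
  assumes "2 \<le> T"
  defines "K \<equiv> nat \<lfloor>log 2 (real T)\<rfloor>"
  shows "2 ^ K \<le> T" "0 < K" "log 2 (real T) \<le> 2 * real K"
proof -
  have L: "1 \<le> log 2 (real T)" by (rule depth_bounds [OF assms(1)])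
  then have 1: "1 \<le> \<lfloor>log 2 (real T)\<rfloor>" by (simp add: le_floor_iff)
  then have K: "real K = of_int \<lfloor>log 2 (real T)\<rfloor>" by (simp add: K_def)
  show "0 < K" using 1 by (simp add: K_def)
  then show "log 2 (real T) \<le> 2 * real K" using K floor_correct [of "log 2 (real T)"] by linarith
  have "real (2 ^ K) = 2 powr real K" by (simp add: powr_realpow)
  also have "\<dots> \<le> 2 powr log 2 (real T)" using K by (intro powr_mono) auto
  also have "\<dots> = real T" using assms(1) by simp
  finally show "2 ^ K \<le> T" by (simp only: of_nat_le_iff)
qed

text \<open>The mean is at least \<open>K * 4 ^ K / 16\<close> and the ceiling is
  \<open>K * 4 ^ K / 2\<close>; half the mean is reached with probability at least
  \<open>(1 / 16) / (2 * (1 / 2))\<close>.\<close>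

lemma isolated_mass_probability:
  assumes T: "2 ^ K \<le> T" and K: "0 < K"
  shows "1 / 16 \<le> measure (points T) {x \<in> space (points T).
     real K * 4 ^ K / 32 \<le> isolated_mass K (\<lambda>s. cell (K + 2) (x (Suc s)))}"
proof -
  interpret prob_space "points T" by (rule prob_space_points)
  have "(real K * 4 ^ K / 16) / (2 * (real K * 4 ^ K / 2)) \<le> prob {x \<in> space (points T).
     (real K * 4 ^ K / 16) / 2 \<le> isolated_mass K (\<lambda>s. cell (K + 2) (x (Suc s)))}"
    using K by (intro reverse_Markov isolated_mass_expectation T isolated_mass_le) auto
  then show ?thesis using K by simp
qed

text \<open>The sample space contains tuples outside the unit cube, so membership holds almost
  surely only.\<close>

lemma AE_points_unit: "AE x in points T. \<forall>s\<in>{1..T}. x s \<in> {0..1}"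
proof -
  have "AE y in unif. y \<in> {0..1}" by (rule AE_uniform_measureI) auto
  then have "AE x in points T. x s \<in> {0..1}" if "s \<in> {1..T}" for s
    unfolding points_def using that by (intro AE_PiM_component prob_space_unif)
  then show ?thesis by (intro AE_finite_allI) auto
qed

lemma sqrt_log_le_max_disc:
  assumes T: "2 \<le> T" and x: "\<And>s. s \<in> {1..T} \<Longrightarrow> x s \<in> {0..1}"
    and \<sigma>: "\<And>s. s \<in> {1..T} \<Longrightarrow> \<bar>\<sigma> s\<bar> = 1"
  defines "K \<equiv> nat \<lfloor>log 2 (real T)\<rfloor>"
  assumes X: "real K * 4 ^ K / 32 \<le> isolated_mass K (\<lambda>s. cell (K + 2) (x (Suc s)))"
  shows "1 / 256 * sqrt (log 2 (real T)) \<le> max_disc T \<sigma> x"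
proof -
  have K: "2 ^ K \<le> T" "0 < K" "log 2 (real T) \<le> 2 * real K"
    using log_2_floor_bounds [OF T] by (auto simp: K_def)
  have "real K * 4 ^ K / 32 \<le> max_disc T \<sigma> x * (4 * 4 ^ K * sqrt (real K))"
    using X isolated_mass_le_max_disc [OF K(1) x \<sigma>] by (rule order_trans)
  \<comment> \<open>Cancelling the common factor leaves \<open>sqrt K / 128\<close>; passing from
    \<open>K\<close> to \<open>log 2 T \<le> 2 * K\<close> costs at most another factor 2, whence
    \<open>1 / 256\<close>.\<close>
  also have "real K * 4 ^ K / 32 = sqrt (real K) / 128 * (4 * 4 ^ K * sqrt (real K))"
    by simp
  finally have "sqrt (real K) / 128 \<le> max_disc T \<sigma> x"
    using K(2) by (subst (asm) mult_le_cancel_right_pos) auto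
  moreover have "sqrt (log 2 (real T)) \<le> 2 * sqrt (real K)"
  proof (rule real_le_lsqrt)
    show "log 2 (real T) \<le> (2 * sqrt (real K))\<^sup>2" using K by (simp add: power_mult_distrib)
  qed simp
  ultimately show ?thesis by simp
qed

text \<open>The favourable event constrains only the points and defeats every signing. It therefore
  holds for all seeds at once, and its product with the seed space has the same probability.\<close>

lemma randomized_lower_bound:
  fixes N :: "'r measure"
  assumes T: "2 \<le> T" and N: "prob_space N" and A: "randomized_online_algorithm N T A"
  shows "1 / 16 \<le> measure (N \<Otimes>\<^sub>M points T) {(r, x) \<in> space (N \<Otimes>\<^sub>M points T).
      1 / 256 * sqrt (log 2 (real T)) \<le> max_disc T (signing (A r) x) x}"
proof -
  interpret N: prob_space N by (rule N)
  interpret P: prob_space "points T" by (rule prob_space_points)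
  interpret NP: pair_prob_space N "points T" ..
  define K where "K = nat \<lfloor>log 2 (real T)\<rfloor>"
  have K: "2 ^ K \<le> T" "0 < K" using log_2_floor_bounds [OF T] by (auto simp: K_def)
  define Q where "Q = {x \<in> space (points T).
     real K * 4 ^ K / 32 \<le> isolated_mass K (\<lambda>s. cell (K + 2) (x (Suc s)))}"
  have Q: "Q \<in> sets (points T)"
    using borel_measurable_integrable [OF integrable_isolated_mass [OF K(1)]] unfolding Q_def by measurable
  let ?E = "{\<omega> \<in> space (N \<Otimes>\<^sub>M points T).
      1 / 256 * sqrt (log 2 (real T)) \<le> max_disc T (signing (A (fst \<omega>)) (snd \<omega>)) (snd \<omega>)}"
  have sign: "signing (A r) x t \<in> {-1, 1}"
    and sign_meas: "(\<lambda>\<omega>. signing (A (fst \<omega>)) (snd \<omega>) t) \<in> borel_measurable (N \<Otimes>\<^sub>M points T)"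
    if t: "t \<in> {1..T}" and r: "r \<in> space N" for t r x
  proof -
    have At: "(\<lambda>(r, x). A r t x) \<in> N \<Otimes>\<^sub>M PiM {1..t} (\<lambda>_. borel) \<rightarrow>\<^sub>M count_space {-1, 1}"
      using A t by (simp add: randomized_online_algorithm_def)
    have "restrict x {1..t} \<in> space (PiM {1..t} (\<lambda>_. borel :: real measure))"
      by (simp add: space_PiM)
    then show "signing (A r) x t \<in> {-1, 1}"
      using measurable_space [OF At, of "(r, restrict x {1..t})"] r
      by (simp add: space_pair_measure signing_def)
    have "(\<lambda>x. restrict x {1..t}) \<in> points T \<rightarrow>\<^sub>M PiM {1..t} (\<lambda>_. borel)"
      unfolding measurable_points using t by (intro measurable_restrict_subset) auto
    then have "(\<lambda>\<omega>. (fst \<omega>, restrict (snd \<omega>) {1..t})) \<in> N \<Otimes>\<^sub>M points T \<rightarrow>\<^sub>M N \<Otimes>\<^sub>M PiM {1..t} (\<lambda>_. borel)"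
      by (intro measurable_Pair measurable_fst measurable_compose [OF measurable_snd])
    from measurable_compose [OF this At]
    have "(\<lambda>\<omega>. signing (A (fst \<omega>)) (snd \<omega>) t) \<in> N \<Otimes>\<^sub>M points T \<rightarrow>\<^sub>M count_space {-1, 1}"
      by (simp add: signing_def)
    from measurable_compose [OF this, of "\<lambda>y. y" borel]
    show "(\<lambda>\<omega>. signing (A (fst \<omega>)) (snd \<omega>) t) \<in> borel_measurable (N \<Otimes>\<^sub>M points T)"
      by simp
  qed
  \<comment> \<open>\<open>sign_meas\<close> is stated under the assumption of some seed, which its
    conclusion does not mention; any seed will do.\<close>
  obtain r0 where r0: "r0 \<in> space N" using N.not_empty by blast
  have "(\<lambda>\<omega>. max_disc T (signing (A (fst \<omega>)) (snd \<omega>)) (snd \<omega>)) \<in> borel_measurable (N \<Otimes>\<^sub>M points T)"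
  proof (rule max_disc_measurable)
    show "1 \<le> T" using T by simp
    fix t assume t: "t \<in> {1..T}"
    show "(\<lambda>\<omega>. signing (A (fst \<omega>)) (snd \<omega>) t) \<in> borel_measurable (N \<Otimes>\<^sub>M points T)"
      by (rule sign_meas [OF t r0])
    have "(\<lambda>x. x t) \<in> borel_measurable (points T)"
      unfolding measurable_points by (rule measurable_component_singleton [OF t])
    then show "(\<lambda>\<omega>. snd \<omega> t) \<in> borel_measurable (N \<Otimes>\<^sub>M points T)"
      by (rule measurable_compose [OF measurable_snd])
  qed
  then have E: "?E \<in> sets (N \<Otimes>\<^sub>M points T)" by measurable
  \<comment> \<open>Intersecting with the unit cube is free almost surely and makes the
    deterministic bound valid at every point of the event.\<close>
  define Q' where "Q' = {x \<in> Q. \<forall>s\<in>{1..T}. x s \<in> {0..1}}"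
  have Q': "Q' \<in> sets (points T)"
  proof -
    have eq: "Q' = Q \<inter> {x \<in> space (points T). \<forall>s\<in>{1..T}. x s \<in> {0..1}}"
      using sets.sets_into_space [OF Q] by (auto simp: Q'_def)
    have "{x \<in> space (points T). x s \<in> {0..1}} \<in> sets (points T)" if "s \<in> {1..T}" for s
    proof -
      have meas: "(\<lambda>x. x s) \<in> points T \<rightarrow>\<^sub>M borel"
        unfolding measurable_points by (rule measurable_component_singleton [OF that])
      have "{x \<in> space (points T). x s \<in> {0..1}} = (\<lambda>x. x s) -` {0..1} \<inter> space (points T)"
        by blast
      also have "\<dots> \<in> sets (points T)" by (rule measurable_sets [OF meas]) simp
      finally show ?thesis .
    qed
    then have "{x \<in> space (points T). \<forall>s\<in>{1..T}. x s \<in> {0..1}} \<in> sets (points T)"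
      by (intro sets.sets_Collect_finite_All finite_atLeastAtMost)
    then show ?thesis unfolding eq by (intro sets.Int Q)
  qed
  have sub: "space N \<times> Q' \<subseteq> ?E"
  proof
    fix \<omega> assume \<omega>: "\<omega> \<in> space N \<times> Q'"
    have "\<bar>signing (A (fst \<omega>)) (snd \<omega>) s\<bar> = 1" if "s \<in> {1..T}" for s
      using sign [OF that, of "fst \<omega>" "snd \<omega>"] \<omega> by auto
    then have "1 / 256 * sqrt (log 2 (real T)) \<le> max_disc T (signing (A (fst \<omega>)) (snd \<omega>)) (snd \<omega>)"
      using \<omega> by (intro sqrt_log_le_max_disc T) (auto simp: Q_def Q'_def K_def)
    then show "\<omega> \<in> ?E" using \<omega> by (auto simp: space_pair_measure Q_def Q'_def)
  qed
  have "1 / 16 \<le> measure (points T) Q"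
    unfolding Q_def by (rule isolated_mass_probability [OF K])
  also have "\<dots> \<le> measure (points T) Q'"
  proof (rule P.finite_measure_mono_AE [OF _ Q'])
    show "AE x in points T. x \<in> Q \<longrightarrow> x \<in> Q'"
      using AE_points_unit [of T] by eventually_elim (simp add: Q'_def)
  qed
  also have "\<dots> = measure (N \<Otimes>\<^sub>M points T) (space N \<times> Q')"
    using Q' by (simp add: measure_def P.emeasure_pair_measure_Times N.emeasure_space_1)
  also have "\<dots> \<le> measure (N \<Otimes>\<^sub>M points T) ?E"
    by (rule NP.P.finite_measure_mono [OF sub E])
  also have "?E = {(r, x) \<in> space (N \<Otimes>\<^sub>M points T).
      1 / 256 * sqrt (log 2 (real T)) \<le> max_disc T (signing (A r) x) x}"
    by auto
  finally show ?thesis .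
qed

theorem theorem1p1:
  shows
    "(\<exists>A :: nat \<Rightarrow> nat \<Rightarrow> (nat \<Rightarrow> real) \<Rightarrow> real.
        (\<forall>T. online_algorithm T (A T)) \<and>
        (\<forall>k::nat. \<exists>C>0. \<forall>T\<ge>2.
           measure (points T)
             {x \<in> space (points T). \<forall>I\<in>unit_subintervals.
                (MAX t\<in>{1..T}. disc (signing (A T) x) x t I) \<le> C * (log 2 (real T)) ^ 3}
           \<ge> 1 - 1 / real T ^ k)) \<and>
     (\<exists>c>0. \<exists>p>0. \<forall>T\<ge>2. \<forall>(N :: 'r measure) A.
        prob_space N \<longrightarrow> randomized_online_algorithm N T A \<longrightarrow>
          measure (N \<Otimes>\<^sub>M points T)
            {(r, x) \<in> space (N \<Otimes>\<^sub>M points T).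
               (SUP I\<in>unit_subintervals. MAX t\<in>{1..T}. disc (signing (A r) x) x t I)
                 \<ge> c * sqrt (log 2 (real T))}
          \<ge> p)"
proof (intro conjI)
  show "\<exists>A :: nat \<Rightarrow> nat \<Rightarrow> (nat \<Rightarrow> real) \<Rightarrow> real.
        (\<forall>T. online_algorithm T (A T)) \<and>
        (\<forall>k::nat. \<exists>C>0. \<forall>T\<ge>2.
           measure (points T)
             {x \<in> space (points T). \<forall>I\<in>unit_subintervals.
                (MAX t\<in>{1..T}. disc (signing (A T) x) x t I) \<le> C * (log 2 (real T)) ^ 3}
           \<ge> 1 - 1 / real T ^ k)"
  proof (intro exI conjI allI impI)
    \<comment> \<open>The algorithm is the same for every \<open>k\<close>; the desired exponent
      enters only through the constant in the discrepancy bound.\<close>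
    show "online_algorithm T (greedy_algorithm (depth T))" for T
      by (rule online_greedy_algorithm)
    show "0 < 20 * (real k + 9)" for k by simp
    show "1 - 1 / real T ^ k \<le> measure (points T)
         {x \<in> space (points T). \<forall>I\<in>unit_subintervals.
            (MAX t\<in>{1..T}. disc (signing (greedy_algorithm (depth T)) x) x t I)
              \<le> 20 * (real k + 9) * log 2 (real T) ^ 3}" if "2 \<le> T" for k T
      using greedy_algorithm_high_probability [OF that, of k] that by (simp add: max_disc_le_iff)
  qed
  show "\<exists>c>0. \<exists>p>0. \<forall>T\<ge>2. \<forall>(N :: 'r measure) A.
        prob_space N \<longrightarrow> randomized_online_algorithm N T A \<longrightarrow>
          measure (N \<Otimes>\<^sub>M points T)
            {(r, x) \<in> space (N \<Otimes>\<^sub>M points T).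
               (SUP I\<in>unit_subintervals. MAX t\<in>{1..T}. disc (signing (A r) x) x t I)
                 \<ge> c * sqrt (log 2 (real T))}
          \<ge> p"
    using randomized_lower_bound unfolding max_disc_def
    by (intro exI [of _ "1 / 256"] exI [of _ "1 / 16"] conjI allI impI) auto
qed

end
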